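(* Let $c\in\{0,N\}$. A Gaussian sequence $[x_k]=(x_0,\dots,x_N)$ of $\mathbb{R}^d$-valued vectors with covariance function $C_{l_1,l_2}=\mathrm{Cov}(x_{l_1},x_{l_2})$ is $CM_c$ if and only if $$C_{k,i}=\begin{bmatrix} C_{k,j} & C_{k,c}\end{bmatrix}\begin{bmatrix} C_j & C_{j,c}\\ C_{c,j} & C_c\end{bmatrix}^{+}\begin{bmatrix} C_{j,i}\\ C_{c,i}\end{bmatrix}$$ for all $i,j,k\in[0,N]\setminus\{c\}$ with $i<j<k$, where the superscript $+$ denotes the Moore–Penrose inverse.
   Context: Sequences are indexed by discrete time $[0,N]=(0,1,\dots,N)$; $[x_k]_i^j=(x_i,\dots,x_j)$; $C_i=C_{i,i}$. A Gaussian sequence is jointly Gaussian, with possibly singular covariance. For $c\in\{0,N\}$, $[x_k]$ is $CM_c$ iff conditioned on $x_c$ the sequence is Markov over $[1,N]$ (if $c=0$) or over $[0,N-1]$ (if $c=N$); equivalently, $F(\xi_k|[x_i]_0^j,x_c)=F(\xi_k|x_j,x_c)$ (a.s.) for all $j<k$ in $[0,N]$ and all $\xi_k\in\mathbb{R}^d$, where $F(\cdot|\cdot)$ is the conditional CDF. *)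

theory Defs
  imports "HOL-Probability.Probability"
begin

section \<open>Gaussian sequences\<close>

text \<open>Univariate normal laws; \<open>\<sigma> = 0\<close> gives the point mass at \<open>\<mu>\<close>, which is what admits
  singular covariances below.\<close>

definition normal_law :: "real \<Rightarrow> real \<Rightarrow> real measure" where
  "normal_law \<mu> \<sigma> =
     (if \<sigma> = 0 then return borel \<mu> else density lborel (\<lambda>t. ennreal (normal_density \<mu> \<sigma> t)))"

text \<open>Joint Gaussianity of \<open>x\<^sub>0, \<dots>, x\<^sub>N\<close>: every linear functional of the stacked vector is
  normal, possibly degenerate.\<close>

definition gaussian_sequence :: "'a measure \<Rightarrow> nat \<Rightarrow> (nat \<Rightarrow> 'a \<Rightarrow> real^'d) \<Rightarrow> bool" where
  "gaussian_sequence M N x \<longleftrightarrow>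
     (\<forall>k\<in>{0..N}. x k \<in> borel_measurable M) \<and>
     (\<forall>u :: nat \<Rightarrow> real^'d. \<exists>\<mu> \<sigma>. 0 \<le> \<sigma> \<and>
        distr M borel (\<lambda>\<omega>. \<Sum>k\<in>{0..N}. u k \<bullet> x k \<omega>) = normal_law \<mu> \<sigma>)"

definition cov_matrix ::
    "'a measure \<Rightarrow> ('a \<Rightarrow> real^'m) \<Rightarrow> ('a \<Rightarrow> real^'n) \<Rightarrow> real^'n^'m" where
  "cov_matrix M X Y =
     (\<chi> a b. \<integral>\<omega>. (X \<omega> - integral\<^sup>L M X) $ a * (Y \<omega> - integral\<^sup>L M Y) $ b \<partial>M)"


section \<open>Conditionally Markov sequences\<close>

definition generated_algebra ::
    "'a measure \<Rightarrow> (nat \<Rightarrow> 'a \<Rightarrow> real^'d) \<Rightarrow> nat set \<Rightarrow> 'a measure" where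
  "generated_algebra M x I =
     sigma (space M) (\<Union>i\<in>I. {x i -` B \<inter> space M |B. B \<in> sets borel})"

text \<open>The conditional CDF \<open>F(\<xi> | x\<^sub>i, i \<in> I)\<close> of \<open>X\<close>, as a random variable; \<open>\<le>\<close> on \<open>real^'d\<close> is
  componentwise.\<close>

definition cond_cdf ::
    "'a measure \<Rightarrow> ('a \<Rightarrow> real^'d) \<Rightarrow> (nat \<Rightarrow> 'a \<Rightarrow> real^'d) \<Rightarrow> nat set \<Rightarrow> real^'d \<Rightarrow> 'a \<Rightarrow> real" where
  "cond_cdf M X x I \<xi> =
     real_cond_exp M (generated_algebra M x I) (indicator {\<omega> \<in> space M. X \<omega> \<le> \<xi>})"

text \<open>The property \<open>CM\<^sub>c\<close> on \<open>[0,N]\<close>, meant for \<open>c \<in> {0, N}\<close>: given \<open>x\<^sub>c\<close>, the remaining sequence is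
  Markov.  The instances where \<open>j\<close> or \<open>k\<close> equals \<open>c\<close> hold trivially.\<close>

definition cond_markov :: "'a measure \<Rightarrow> nat \<Rightarrow> nat \<Rightarrow> (nat \<Rightarrow> 'a \<Rightarrow> real^'d) \<Rightarrow> bool" where
  "cond_markov M N c x \<longleftrightarrow>
     (\<forall>j\<in>{0..N}. \<forall>k\<in>{0..N}. j < k \<longrightarrow>
        (\<forall>\<xi>. AE \<omega> in M.
           cond_cdf M (x k) x ({0..j} \<union> {c}) \<xi> \<omega> = cond_cdf M (x k) x {j, c} \<xi> \<omega>))"


section \<open>Block matrices and the Moore--Penrose inverse\<close>

text \<open>\<open>hblock A B\<close> is \<open>[A B]\<close>; \<open>vblock A B\<close> puts \<open>A\<close> above \<open>B\<close>.\<close>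

definition hblock :: "'a^'m^'p \<Rightarrow> 'a^'n^'p \<Rightarrow> 'a^('m + 'n)^'p" where
  "hblock A B = (\<chi> i j. case j of Inl l \<Rightarrow> A $ i $ l | Inr l \<Rightarrow> B $ i $ l)"

definition vblock :: "'a^'p^'m \<Rightarrow> 'a^'p^'n \<Rightarrow> 'a^'p^('m + 'n)" where
  "vblock A B = (\<chi> i. case i of Inl l \<Rightarrow> A $ l | Inr l \<Rightarrow> B $ l)"

definition is_moore_penrose :: "real^'n^'m \<Rightarrow> real^'m^'n \<Rightarrow> bool" where
  "is_moore_penrose A X \<longleftrightarrow>
     A ** X ** A = A \<and> X ** A ** X = X \<and>
     transpose (A ** X) = A ** X \<and> transpose (X ** A) = X ** A"

text \<open>By Penrose's theorem every real matrix has exactly one such \<open>X\<close>.\<close>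

definition moore_penrose :: "real^'n^'m \<Rightarrow> real^'m^'n" where
  "moore_penrose A = (THE X. is_moore_penrose A X)"

end

theory Submission
  imports Defs
begin

text \<open>
  Fix \<open>j < k\<close>, both different from \<open>c\<close>, and let \<open>u\<close> be the residual of the linear regression of
  \<open>x\<^sub>k\<close> on \<open>(x\<^sub>j, x\<^sub>c)\<close>, whose coefficient matrix involves the Moore--Penrose inverse. The
  covariance identity for \<open>i\<close> says that \<open>u\<close> is uncorrelated with \<open>x\<^sub>i\<close>; it is automatic for
  \<open>i = j\<close> and \<open>i = c\<close>. Let \<open>\<S>\<close> and \<open>\<T>\<close> be the \<open>\<sigma>\<close>-algebras of \<open>(x\<^sub>0, \<dots>, x\<^sub>j, x\<^sub>c)\<close> and
  \<open>(x\<^sub>j, x\<^sub>c)\<close>. Equality of the two conditional CDFs means that the weights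
  \<open>W = 1\<^sub>F - P(F | \<T>)\<close> with \<open>F \<in> \<S>\<close> satisfy \<open>E(W; x\<^sub>k \<le> \<xi>) = 0\<close> for all \<open>\<xi>\<close>.

  If \<open>u\<close> is uncorrelated with \<open>x\<^sub>0, \<dots>, x\<^sub>j, x\<^sub>c\<close>, it is independent of \<open>\<S>\<close>, so
  \<open>E(W exp(i s \<bullet> x\<^sub>k))\<close> factors, with a second factor that vanishes since \<open>W\<close> is orthogonal to
  \<open>\<T>\<close>-measurable functions; uniqueness of characteristic functions gives \<open>E(W; x\<^sub>k \<le> \<xi>) = 0\<close>.
  Conversely, \<open>E(W; x\<^sub>k \<le> \<xi>) = 0\<close> for all \<open>\<xi>\<close> implies \<open>E(W x\<^sub>k) = 0\<close>, hence \<open>E(W u) = 0\<close> and,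
  \<open>u\<close> being independent of \<open>\<T>\<close>, \<open>E(u; F) = 0\<close> for all \<open>F \<in> \<S>\<close>, so \<open>u\<close> is uncorrelated with
  every \<open>\<S>\<close>-measurable \<open>x\<^sub>i\<close>.
\<close>

section \<open>The Moore--Penrose inverse\<close>

text \<open>If \<open>transpose A ** A\<close> kills \<open>d\<close>, then |A d|^2 = d . (A^T A d)
  = 0, so \<open>A\<close> kills \<open>d\<close> as well; this is used with \<open>d\<close> the
  difference of the images of \<open>w\<close> under \<open>U\<close> and \<open>V\<close>.\<close>

lemma matrix_cancel_left_transpose:
  fixes A :: "real^'n^'m" and U V :: "real^'p^'n"
  assumes "transpose A ** A ** U = transpose A ** A ** V"
  shows "A ** U = A ** V"
proof -
  have "(A ** U) *v w = (A ** V) *v w" for w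
  proof -
    define d where "d = U *v w - V *v w"
    have "transpose A *v (A *v d) = 0"
      using arg_cong[OF assms, of "\<lambda>B. B *v w"]
      by (simp add: d_def matrix_vector_mult_diff_distrib matrix_vector_mul_assoc matrix_mul_assoc)
    hence "(A *v d) \<bullet> (A *v d) = 0"
      by (metis dot_lmul_matrix inner_zero_right vector_transpose_matrix transpose_transpose inner_commute)
    thus ?thesis
      by (simp add: d_def matrix_vector_mult_diff_distrib matrix_vector_mul_assoc)
  qed
  thus ?thesis by (simp add: matrix_eq)
qed

lemma matrix_cancel_right_transpose:
  fixes A :: "real^'n^'m" and U V :: "real^'m^'p"
  assumes "U ** A ** transpose A = V ** A ** transpose A"
  shows "U ** A = V ** A"
proof -
  have "transpose (U ** A ** transpose A) = transpose (V ** A ** transpose A)"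
    using assms by simp
  hence "A ** transpose A ** transpose U = A ** transpose A ** transpose V"
    by (simp add: matrix_transpose_mul matrix_mul_assoc)
  hence "transpose A ** transpose U = transpose A ** transpose V"
    using matrix_cancel_left_transpose[of "transpose A" "transpose U" "transpose V"] by simp
  thus ?thesis by (metis matrix_transpose_mul transpose_transpose)
qed

text \<open>A linear map choosing preimages on the range of \<open>A\<close> exists, and its matrix
  serves as \<open>Y\<close>.\<close>

lemma exists_inner_inverse_matrix:
  fixes A :: "real^'n^'m"
  shows "\<exists>Y::real^'m^'n. A ** Y ** A = A"
proof -
  obtain g where g: "linear g" "\<And>v. v \<in> range ((*v) A) \<Longrightarrow> A *v (g v) = v"
    using linear_exists_right_inverse_on[of "(*v) A" UNIV]
    by (auto intro: matrix_vector_mul_linear)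
  have "(A ** matrix g ** A) *v w = A *v w" for w
    using g by (simp add: matrix_works matrix_vector_mul_assoc[symmetric])
  thus ?thesis by (metis matrix_eq)
qed

lemma exists_moore_penrose:
  fixes A :: "real^'n^'m"
  shows "\<exists>X. is_moore_penrose A X"
proof -
  let ?T = "transpose A"
  obtain Y where Y: "(?T ** A ** ?T) ** Y ** (?T ** A ** ?T) = ?T ** A ** ?T"
    using exists_inner_inverse_matrix by blast
  \<comment> \<open>\<open>X\<close> satisfies all Penrose equations except possibly \<open>X A X = X\<close>, which \<open>X A X\<close> repairs.\<close>
  define X where "X = ?T ** Y ** ?T"
  have "?T ** A ** (?T ** Y ** ?T ** A ** ?T) = ?T ** A ** ?T"
    using Y by (simp add: matrix_mul_assoc)
  \<comment> \<open>The leading transpose is cancelled here and the trailing one below, where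
    \<open>mat 1\<close> only puts the right-hand side into the shape of the cancellation
    rule.\<close>
  hence "A ** (?T ** Y ** ?T ** A ** ?T) = A ** ?T"
    by (rule matrix_cancel_left_transpose)
  hence "(A ** X) ** A ** ?T = mat 1 ** A ** ?T"
    by (simp add: matrix_mul_assoc X_def)
  hence AXA: "A ** X ** A = A"
    using matrix_cancel_right_transpose by fastforce
  have "A ** X = A ** ?T ** Y ** ?T" by (simp add: X_def matrix_mul_assoc)
  \<comment> \<open>With P = A X this yields P P^T = P, and P P^T is symmetric. The product
    \<open>X ** A\<close> is treated in the mirrored way.\<close>
  hence "(A ** X) ** transpose (A ** X) = (A ** ?T ** Y) ** transpose (A ** X ** A)"
    by (metis matrix_mul_assoc matrix_transpose_mul)
  hence "(A ** X) ** transpose (A ** X) = A ** X"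
    using AXA by (simp add: X_def matrix_mul_assoc)
  hence s1: "transpose (A ** X) = A ** X"
    by (metis matrix_transpose_mul transpose_transpose)
  have "X ** A = ?T ** (Y ** ?T ** A)" by (simp add: X_def matrix_mul_assoc)
  hence "transpose (X ** A) ** (X ** A) = transpose (Y ** ?T ** A) ** (A ** X ** A)"
    by (metis matrix_mul_assoc matrix_transpose_mul transpose_transpose)
  hence "transpose (X ** A) ** (X ** A) = transpose (X ** A)"
    using AXA \<open>X ** A = ?T ** (Y ** ?T ** A)\<close>
    by (metis matrix_transpose_mul transpose_transpose)
  hence s2: "transpose (X ** A) = X ** A"
    by (metis matrix_transpose_mul transpose_transpose)
  have AXAX: "A ** (X ** A ** X) = A ** X" "(X ** A ** X) ** A = X ** A"
    using AXA by (metis matrix_mul_assoc)+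
  have "is_moore_penrose A (X ** A ** X)"
    unfolding is_moore_penrose_def AXAX using AXA s1 s2
    by (metis matrix_mul_assoc)
  thus ?thesis ..
qed

text \<open>By symmetry of the products, A X = (A Y A X)^T = A X A Y = A Y, and likewise X A = Y A;
  hence X = X A X = X A Y = Y A Y = Y.\<close>

lemma moore_penrose_unique:
  assumes "is_moore_penrose A X" "is_moore_penrose A Y"
  shows "X = Y"
proof -
  note X = assms(1)[unfolded is_moore_penrose_def]
  note Y = assms(2)[unfolded is_moore_penrose_def]
  have "A ** X = transpose (A ** X) ** transpose (A ** Y)"
    using X Y by (metis matrix_mul_assoc matrix_transpose_mul)
  hence 1: "A ** X = A ** Y"
    using X Y by (metis matrix_mul_assoc)
  have "X ** A = transpose (Y ** A) ** transpose (X ** A)"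
    using X Y by (metis matrix_mul_assoc matrix_transpose_mul)
  hence 2: "X ** A = Y ** A"
    using X Y by (metis matrix_mul_assoc)
  show ?thesis using X Y 1 2 by (metis matrix_mul_assoc)
qed

lemma is_moore_penrose_moore_penrose: "is_moore_penrose A (moore_penrose A)"
  unfolding moore_penrose_def
  using exists_moore_penrose[of A] moore_penrose_unique by (metis theI)


section \<open>Weights with vanishing Fourier transform\<close>

text \<open>The sets over which \<open>W\<close> integrates to zero form a Dynkin system, with
  \<open>W0\<close> giving closure under complements, so the pi-lambda theorem applies.\<close>

lemma integral_indicator_zero_sigma_sets:
  fixes W :: "'a \<Rightarrow> 'b::{banach, second_countable_topology}"
  assumes W: "integrable M W" and W0: "(\<integral>x. W x \<partial>M) = 0"
    and G: "Int_stable G" "G \<subseteq> sets M"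
    and z: "\<And>A. A \<in> G \<Longrightarrow> (\<integral>x. indicator A x *\<^sub>R W x \<partial>M) = 0"
    and A: "A \<in> sigma_sets (space M) G"
  shows "(\<integral>x. indicator A x *\<^sub>R W x \<partial>M) = 0"
proof -
  have GP: "G \<subseteq> Pow (space M)" using G(2) sets.sets_into_space by blast
  have S: "B \<in> sets M" if "B \<in> sigma_sets (space M) G" for B
    using sets.sigma_sets_subset[OF G(2)] that by blast
  from G(1) GP A show ?thesis
  proof (induction rule: sigma_sets_induct_disjoint)
    case (basic A)
    then show ?case by (rule z)
  next
    case empty
    then show ?case by simp
  next
    case (compl A)
    have "(\<integral>x. indicator (space M - A) x *\<^sub>R W x \<partial>M)
        = (\<integral>x. W x - indicator A x *\<^sub>R W x \<partial>M)"
      by (intro Bochner_Integration.integral_cong) (auto split: split_indicator)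
    also have "\<dots> = 0"
      using compl S[OF compl(1)] W W0
      by (subst Bochner_Integration.integral_diff) (auto intro!: integrable_mult_indicator)
    finally show ?case .
  next
    case (union A)
    have "A i \<in> sets M" for i using union(2) S by blast
    hence "(\<integral>x\<in>(\<Union>i. A i). W x \<partial>M) = (\<Sum>i. \<integral>x\<in>A i. W x \<partial>M)"
      using union(1) W
      by (intro lebesgue_integral_countable_add)
        (auto simp: disjoint_family_on_def set_integrable_def
          intro!: integrable_mult_indicator sets.countable_UN)
    then show ?case using union by (simp add: set_lebesgue_integral_def)
  qed
qed

context prob_space
begin

text \<open>Splitting \<open>W\<close> into positive and negative parts and normalising turns this into Levy's
  uniqueness theorem for two probability measures.\<close>

lemma indicator_integral_zero_of_char_zero_real:
  fixes W Z :: "'a \<Rightarrow> real"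
  assumes W: "integrable M W" and Z[measurable]: "Z \<in> borel_measurable M"
    and z: "\<And>t. (\<integral>\<omega>. W \<omega> * cis (t * Z \<omega>) \<partial>M) = 0"
    and B[measurable]: "B \<in> sets borel"
  shows "(\<integral>\<omega>. W \<omega> * indicator B (Z \<omega>) \<partial>M) = 0"
proof -
  have [measurable]: "W \<in> borel_measurable M" using W by auto
  define Wp where "Wp = (\<lambda>\<omega>. max 0 (W \<omega>))"
  define Wm where "Wm = (\<lambda>\<omega>. max 0 (- W \<omega>))"
  have [measurable]: "Wp \<in> borel_measurable M" "Wm \<in> borel_measurable M"
    by (auto simp: Wp_def Wm_def)
  have Wpi: "integrable M Wp" and Wmi: "integrable M Wm"
    using W by (auto simp: Wp_def Wm_def)
  have Weq: "W \<omega> = Wp \<omega> - Wm \<omega>" for \<omega> by (auto simp: Wp_def Wm_def)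
  have nn: "Wp \<omega> \<ge> 0" "Wm \<omega> \<ge> 0" for \<omega> by (auto simp: Wp_def Wm_def)
  define m where "m = (\<integral>\<omega>. Wp \<omega> \<partial>M)"
  \<comment> \<open>Frequency 0 shows that the positive and negative parts have the same mass
    \<open>m\<close>, so one constant normalises both.\<close>
  have "complex_of_real (\<integral>\<omega>. W \<omega> \<partial>M) = 0" using z[of 0] by simp
  hence "(\<integral>\<omega>. W \<omega> \<partial>M) = 0" by simp
  hence m': "(\<integral>\<omega>. Wm \<omega> \<partial>M) = m" unfolding Weq m_def using Wpi Wmi by simp
  have m0: "m \<ge> 0" unfolding m_def using nn by simp
  show ?thesis
  proof (cases "m = 0")
    case True
    hence "AE \<omega> in M. Wp \<omega> = 0" "AE \<omega> in M. Wm \<omega> = 0"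
      using integral_nonneg_eq_0_iff_AE[OF Wpi] integral_nonneg_eq_0_iff_AE[OF Wmi] nn m'
      by (auto simp: m_def)
    hence "AE \<omega> in M. W \<omega> * indicator B (Z \<omega>) = 0" by eventually_elim (simp add: Weq)
    thus ?thesis by (simp add: integral_eq_zero_AE)
  next
    case False
    with m0 have m: "m > 0" by simp
    \<comment> \<open>The law of \<open>Z\<close> after reweighting the probability by V/m.\<close>
    define D where "D V = distr (density M (\<lambda>\<omega>. ennreal (V \<omega> / m))) borel Z" for V
    have DI: "(\<integral>x. f x \<partial>D V) = (\<integral>\<omega>. (V \<omega> / m) *\<^sub>R f (Z \<omega>) \<partial>M)"
      if [measurable]: "f \<in> borel_measurable borel" "V \<in> borel_measurable M" and "\<And>\<omega>. V \<omega> \<ge> 0"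
      for f :: "real \<Rightarrow> 'b::{banach,second_countable_topology}" and V
      using m that(3) unfolding D_def by (simp add: integral_distr integral_density)
    have RD: "real_distribution (D V)"
      if "integrable M V" and [measurable]: "V \<in> borel_measurable M" and "\<And>\<omega>. V \<omega> \<ge> 0"
        and "(\<integral>\<omega>. V \<omega> \<partial>M) = m" for V
    proof -
      have "prob_space (density M (\<lambda>\<omega>. ennreal (V \<omega> / m)))"
        using m that
        by (intro prob_spaceI) (simp add: emeasure_density nn_integral_eq_integral)
      thus ?thesis unfolding D_def
        by (intro real_distribution.intro prob_space.prob_space_distr) (auto simp: real_distribution_axioms_def)
    qed
    have I: "integrable M (\<lambda>\<omega>. V \<omega> *\<^sub>R cis (t * Z \<omega>))" if "integrable M V" for V :: "'a \<Rightarrow> real" and t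
      by (rule Bochner_Integration.integrable_bound[OF that]) (use that in \<open>auto simp: cis_conv_exp\<close>)
    have "char (D Wp) t = char (D Wm) t" for t
    proof -
      have "(\<integral>\<omega>. Wp \<omega> *\<^sub>R cis (t * Z \<omega>) \<partial>M) - (\<integral>\<omega>. Wm \<omega> *\<^sub>R cis (t * Z \<omega>) \<partial>M)
         = (\<integral>\<omega>. W \<omega> * cis (t * Z \<omega>) \<partial>M)"
        unfolding Weq
        by (subst Bochner_Integration.integral_diff[symmetric])
          (use I[OF Wpi] I[OF Wmi] in \<open>auto simp: scaleR_conv_of_real algebra_simps\<close>)
      hence "(\<integral>\<omega>. Wp \<omega> *\<^sub>R cis (t * Z \<omega>) \<partial>M) = (\<integral>\<omega>. Wm \<omega> *\<^sub>R cis (t * Z \<omega>) \<partial>M)"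
        using z by simp
      hence "(\<integral>\<omega>. (1/m) *\<^sub>R (Wp \<omega> *\<^sub>R cis (t * Z \<omega>)) \<partial>M)
        = (\<integral>\<omega>. (1/m) *\<^sub>R (Wm \<omega> *\<^sub>R cis (t * Z \<omega>)) \<partial>M)"
        unfolding integral_scaleR_right by simp
      thus ?thesis
        unfolding char_def using nn by (subst (1 2) DI) (auto simp: cis_conv_exp)
    qed
    hence "D Wp = D Wm"
      by (intro Levy_uniqueness RD) (auto simp: Wpi Wmi nn m' m_def[symmetric])
    hence "(\<integral>x. indicator B x \<partial>D Wp) = ((\<integral>x. indicator B x \<partial>D Wm) :: real)"
      by simp
    hence "(\<integral>\<omega>. Wp \<omega> * indicator B (Z \<omega>) \<partial>M) = (\<integral>\<omega>. Wm \<omega> * indicator B (Z \<omega>) \<partial>M)"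
      using m nn by (subst (asm) (1 2) DI) auto
    moreover have "integrable M (\<lambda>\<omega>. V \<omega> * indicator B (Z \<omega>))"
      if "integrable M V" for V :: "'a \<Rightarrow> real"
      by (rule Bochner_Integration.integrable_bound[OF that]) (use that in \<open>auto split: split_indicator\<close>)
    ultimately show ?thesis
      unfolding Weq left_diff_distrib using Wpi Wmi by simp
  qed
qed

text \<open>Conjugating the hypothesis at -t shows that it also holds for the conjugate weight,
  hence for the real and imaginary parts, to which the real case applies.\<close>

lemma indicator_integral_zero_of_char_zero:
  fixes W :: "'a \<Rightarrow> complex" and Z :: "'a \<Rightarrow> real"
  assumes W: "integrable M W" and Z[measurable]: "Z \<in> borel_measurable M"
    and z: "\<And>t. (\<integral>\<omega>. W \<omega> * cis (t * Z \<omega>) \<partial>M) = 0"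
    and B[measurable]: "B \<in> sets borel"
  shows "(\<integral>\<omega>. W \<omega> * indicator B (Z \<omega>) \<partial>M) = 0"
proof -
  have [measurable]: "W \<in> borel_measurable M" using W by auto
  have I: "integrable M (\<lambda>\<omega>. V \<omega> * cis (t * Z \<omega>))" if "integrable M V" for V :: "'a \<Rightarrow> complex" and t
    by (rule Bochner_Integration.integrable_bound[OF that])
      (use that in \<open>auto simp: cis_conv_exp norm_mult\<close>)
  have c: "(\<integral>\<omega>. cnj (W \<omega>) * cis (t * Z \<omega>) \<partial>M) = 0" for t
  proof -
    have "(\<integral>\<omega>. cnj (W \<omega>) * cis (t * Z \<omega>) \<partial>M) = (\<integral>\<omega>. cnj (W \<omega> * cis ((-t) * Z \<omega>)) \<partial>M)"
      by (simp add: cis_cnj)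
    also have "\<dots> = 0" using z[of "-t"] by (simp only: Bochner_Integration.integral_cnj complex_cnj_zero)
    finally show ?thesis .
  qed
  have "(\<integral>\<omega>. Re (W \<omega>) * indicator B (Z \<omega>) \<partial>M) = 0"
  proof (rule indicator_integral_zero_of_char_zero_real)
    fix t
    have "(\<integral>\<omega>. Re (W \<omega>) * cis (t * Z \<omega>) \<partial>M)
      = (\<integral>\<omega>. (W \<omega> * cis (t * Z \<omega>) + cnj (W \<omega>) * cis (t * Z \<omega>)) / 2 \<partial>M)"
      by (intro Bochner_Integration.integral_cong refl)
        (metis complex_add_cnj distrib_right mult.commute nonzero_mult_div_cancel_left of_real_mult
          of_real_numeral times_divide_eq_right zero_neq_numeral)
    also have "\<dots> = 0"
      using z c by (simp add: I W)
    finally show "(\<integral>\<omega>. Re (W \<omega>) * cis (t * Z \<omega>) \<partial>M) = 0" .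
  qed (use W in auto)
  moreover have "(\<integral>\<omega>. Im (W \<omega>) * indicator B (Z \<omega>) \<partial>M) = 0"
  proof (rule indicator_integral_zero_of_char_zero_real)
    fix t
    have "(\<integral>\<omega>. Im (W \<omega>) * cis (t * Z \<omega>) \<partial>M)
      = (\<integral>\<omega>. (W \<omega> * cis (t * Z \<omega>) - cnj (W \<omega>) * cis (t * Z \<omega>)) / (2 * \<i>) \<partial>M)"
      by (intro Bochner_Integration.integral_cong refl)
        (simp add: left_diff_distrib[symmetric] complex_diff_cnj field_simps)
    also have "\<dots> = 0"
      using z c by (simp add: I W)
    finally show "(\<integral>\<omega>. Im (W \<omega>) * cis (t * Z \<omega>) \<partial>M) = 0" .
  qed (use W in auto)
  moreover have "integrable M (\<lambda>\<omega>. W \<omega> * indicator B (Z \<omega>))"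
    by (rule Bochner_Integration.integrable_bound[OF W]) (auto split: split_indicator)
  moreover have "Re (indicator B z) = indicator B z" "Im (indicator B z) = 0" for z
    by (auto split: split_indicator)
  ultimately show ?thesis
    by (simp add: complex_eq_iff integral_Re[symmetric] integral_Im[symmetric] del: integral_Re integral_Im)
qed

end

section \<open>Sigma-algebras generated by part of the sequence\<close>

lemma space_generated_algebra [simp]: "space (generated_algebra M x S) = space M"
  by (auto simp: generated_algebra_def space_measure_of_conv)

lemma sets_generated_algebra:
  "sets (generated_algebra M x S) =
     sigma_sets (space M) (\<Union>i\<in>S. {x i -` B \<inter> space M |B. B \<in> sets borel})"
  by (auto simp: generated_algebra_def intro!: sets_measure_of)

lemma measurable_generated_algebra:
  assumes "i \<in> S"
  shows "x i \<in> borel_measurable (generated_algebra M x S)"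
  using assms by (intro measurableI) (auto simp: sets_generated_algebra)

lemma generated_algebra_least:
  assumes "space A = space M" "\<And>i. i \<in> S \<Longrightarrow> x i \<in> borel_measurable A"
  shows "sets (generated_algebra M x S) \<subseteq> sets A"
  unfolding sets_generated_algebra assms(1)[symmetric]
  using assms(2) by (intro sets.sigma_sets_subset) (auto dest: measurable_sets)

lemma generated_algebra_mono:
  assumes "S \<subseteq> T"
  shows "sets (generated_algebra M x S) \<subseteq> sets (generated_algebra M x T)"
  using assms by (intro generated_algebra_least measurable_generated_algebra) auto

lemma subalgebra_generated_algebra:
  assumes "\<And>i. i \<in> S \<Longrightarrow> x i \<in> borel_measurable M"
  shows "subalgebra M (generated_algebra M x S)"
  unfolding subalgebra_def using generated_algebra_least[OF refl assms] by simp

lemma borel_measurable_vecI: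
  fixes f :: "'a \<Rightarrow> real^'n"
  assumes "\<And>a. (\<lambda>\<omega>. f \<omega> $ a) \<in> borel_measurable M"
  shows "f \<in> borel_measurable M"
  using assms by (subst borel_measurable_euclidean_space) (auto simp: Basis_vec_def inner_axis)

lemma borel_measurable_vec_component [measurable (raw)]:
  fixes f :: "'a \<Rightarrow> real^'n"
  assumes "f \<in> borel_measurable M"
  shows "(\<lambda>\<omega>. f \<omega> $ a) \<in> borel_measurable M"
proof -
  have "(\<lambda>\<omega>. f \<omega> \<bullet> axis a 1) \<in> borel_measurable M" using assms by simp
  thus ?thesis by (simp add: inner_axis)
qed

context prob_space
begin

text \<open>The exponentials are traded for indicators one variable at a time, the remaining factors
  being absorbed into the weight; this replaces a multivariate version of Levy's theorem.\<close>

lemma prod_indicator_integral_zero_of_char_zero: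
  fixes W :: "'a \<Rightarrow> complex" and Z :: "'i \<Rightarrow> 'a \<Rightarrow> real"
  assumes "finite I" and W: "integrable M W"
    and "\<And>i. i \<in> I \<Longrightarrow> Z i \<in> borel_measurable M"
    and "\<And>t. (\<integral>\<omega>. W \<omega> * cis (\<Sum>i\<in>I. t i * Z i \<omega>) \<partial>M) = 0"
    and "\<And>i. i \<in> I \<Longrightarrow> B i \<in> sets borel"
  shows "(\<integral>\<omega>. W \<omega> * (\<Prod>i\<in>I. indicator (B i) (Z i \<omega>)) \<partial>M) = 0"
  using assms
proof (induction I arbitrary: W)
  case empty
  then show ?case by simp
next
  case (insert a I)
  note [measurable] = insert.prems(2,4)
  have [measurable]: "Z a \<in> borel_measurable M" "B a \<in> sets borel" "W \<in> borel_measurable M"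
    using insert.prems by auto
  have 1: "(\<integral>\<omega>. (W \<omega> * (\<Prod>i\<in>I. indicator (B i) (Z i \<omega>))) * cis (s * Z a \<omega>) \<partial>M) = 0" for s
  proof -
    \<comment> \<open>The exponential of the new variable has modulus 1 and joins the weight; the
      hypothesis at the frequencies \<open>t(a := s)\<close> is what the induction hypothesis asks
      of this weight.\<close>
    have "(\<integral>\<omega>. (W \<omega> * cis (s * Z a \<omega>)) * (\<Prod>i\<in>I. indicator (B i) (Z i \<omega>)) \<partial>M) = 0"
    proof (rule insert.IH)
      show "integrable M (\<lambda>\<omega>. W \<omega> * cis (s * Z a \<omega>))"
        by (rule Bochner_Integration.integrable_bound[OF insert.prems(1)])
          (auto simp: cis_conv_exp norm_mult)
    next
      fix t
      have "(\<Sum>i\<in>I. (t(a := s)) i * Z i \<omega>) = (\<Sum>i\<in>I. t i * Z i \<omega>)" for \<omega>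
        using insert.hyps by (intro sum.cong) auto
      with insert.hyps have e: "W \<omega> * cis (\<Sum>i\<in>insert a I. (t(a := s)) i * Z i \<omega>)
          = W \<omega> * cis (s * Z a \<omega>) * cis (\<Sum>i\<in>I. t i * Z i \<omega>)" for \<omega>
        by (simp add: cis_mult del: fun_upd_apply) simp
      from insert.prems(3)[of "t(a := s)"]
      show "(\<integral>\<omega>. W \<omega> * cis (s * Z a \<omega>) * cis (\<Sum>i\<in>I. t i * Z i \<omega>) \<partial>M) = 0"
        unfolding e .
    qed (use insert.prems in auto)
    thus ?thesis by (simp add: mult_ac)
  qed
  have pm: "(\<lambda>\<omega>. (\<Prod>i\<in>I. indicator (B i) (Z i \<omega>) :: complex)) \<in> borel_measurable M"
    using insert.prems by (intro borel_measurable_prod) auto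
  \<comment> \<open>Now the indicators join the weight, which stays integrable, and the univariate
    lemma trades the last exponential.\<close>
  have "norm (\<Prod>i\<in>I. indicator (B i) (Z i \<omega>) :: complex) \<le> 1" for \<omega>
    by (subst prod_norm[symmetric]) (auto intro!: prod_le_1 split: split_indicator)
  hence "integrable M (\<lambda>\<omega>. W \<omega> * (\<Prod>i\<in>I. indicator (B i) (Z i \<omega>)))"
    using pm
    by (intro Bochner_Integration.integrable_bound[OF insert.prems(1)])
      (auto simp: norm_mult intro!: mult_left_le)
  from indicator_integral_zero_of_char_zero[OF this _ 1, of "B a"]
  show ?case using insert.hyps by (simp add: mult_ac)
qed

text \<open>Splitting the vectors into scalar coordinates makes the product lemma applicable to
  boxes. The boxes form a pi-system that generates the algebra, so vanishing on them
  suffices.\<close>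

lemma integral_zero_generated_algebra_of_char_zero:
  fixes W :: "'a \<Rightarrow> complex" and x :: "nat \<Rightarrow> 'a \<Rightarrow> real^'d"
  assumes S: "finite S" and x: "\<And>i. i \<in> S \<Longrightarrow> x i \<in> borel_measurable M"
    and W: "integrable M W"
    and z: "\<And>p. (\<integral>\<omega>. W \<omega> * cis (\<Sum>i\<in>S. p i \<bullet> x i \<omega>) \<partial>M) = 0"
    and F: "F \<in> sets (generated_algebra M x S)"
  shows "(\<integral>\<omega>. indicator F \<omega> *\<^sub>R W \<omega> \<partial>M) = 0"
proof -
  define I where "I = S \<times> (UNIV :: 'd set)"
  define Z where "Z = (\<lambda>q \<omega>. x (fst q) \<omega> $ snd q)"
  define R where "R B = {\<omega>\<in>space M. \<forall>q\<in>I. Z q \<omega> \<in> B q}" for B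
  define G where "G = R ` {B. \<forall>q. B q \<in> sets borel}"
  have Zm[measurable]: "Z q \<in> borel_measurable M" if "q \<in> I" for q
    using that x by (auto simp: Z_def I_def)
  have finI: "finite I" using S by (simp add: I_def)
  have GM: "G \<subseteq> sets M"
  proof -
    have "R B \<in> sets M" if B: "\<And>q. B q \<in> sets borel" for B
    proof -
      have "R B = space M \<inter> (\<Inter>q\<in>I. Z q -` B q \<inter> space M)" by (auto simp: R_def)
      also have "\<dots> \<in> sets M"
      proof (cases "I = {}")
        case False
        have "Z q -` B q \<inter> space M \<in> sets M" if "q \<in> I" for q
          by (rule measurable_sets[OF Zm[OF that] B])
        hence "(\<Inter>q\<in>I. Z q -` B q \<inter> space M) \<in> sets M"
          by (rule sets.finite_INT[OF finI False])
        thus ?thesis by (rule sets.Int[OF sets.top])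
      qed simp
      finally show ?thesis .
    qed
    thus ?thesis unfolding G_def by blast
  qed
  have Gs: "Int_stable G"
  proof (rule Int_stableI)
    fix A A' assume "A \<in> G" "A' \<in> G"
    then obtain B B' where "\<forall>q. B q \<in> sets borel" "\<forall>q. B' q \<in> sets borel" "A = R B" "A' = R B'"
      by (auto simp: G_def)
    moreover from this have "\<forall>q. B q \<inter> B' q \<in> sets borel" by blast
    moreover have "R B \<inter> R B' = R (\<lambda>q. B q \<inter> B' q)" by (auto simp: R_def)
    ultimately show "A \<inter> A' \<in> G" unfolding G_def by blast
  qed
  have W0: "(\<integral>\<omega>. W \<omega> \<partial>M) = 0" using z[of "\<lambda>_. 0"] by simp
  have Gz: "(\<integral>\<omega>. indicator A \<omega> *\<^sub>R W \<omega> \<partial>M) = 0" if "A \<in> G" for A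
  proof -
    obtain B where B: "\<And>q. B q \<in> sets borel" and A: "A = R B"
      using \<open>A \<in> G\<close> by (auto simp: G_def)
    have "(\<integral>\<omega>. W \<omega> * (\<Prod>q\<in>I. indicator (B q) (Z q \<omega>)) \<partial>M) = 0"
    proof (rule prod_indicator_integral_zero_of_char_zero[OF finI W])
      fix t
      have "(\<Sum>q\<in>I. t q * Z q \<omega>) = (\<Sum>i\<in>S. (\<chi> a. t (i, a)) \<bullet> x i \<omega>)" for \<omega>
        by (simp add: I_def Z_def inner_vec_def sum.cartesian_product split_def)
      thus "(\<integral>\<omega>. W \<omega> * cis (\<Sum>q\<in>I. t q * Z q \<omega>) \<partial>M) = 0" using z by simp
    qed (use B in auto)
    also have "(\<integral>\<omega>. W \<omega> * (\<Prod>q\<in>I. indicator (B q) (Z q \<omega>)) \<partial>M) = (\<integral>\<omega>. indicator A \<omega> *\<^sub>R W \<omega> \<partial>M)"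
    proof (rule Bochner_Integration.integral_cong)
      fix \<omega> assume "\<omega> \<in> space M"
      hence "(\<Prod>q\<in>I. indicator (B q) (Z q \<omega>)) = (indicator A \<omega> :: complex)"
        using finI by (auto simp: A R_def indicator_def prod_eq_1_iff intro!: prod_zero)
      thus "W \<omega> * (\<Prod>q\<in>I. indicator (B q) (Z q \<omega>)) = indicator A \<omega> *\<^sub>R W \<omega>"
        by (auto split: split_indicator)
    qed simp
    finally show ?thesis .
  qed
  have FG: "F \<in> sigma_sets (space M) G"
  proof -
    let ?A = "sigma (space M) G"
    have sA: "sets ?A = sigma_sets (space M) G" "space ?A = space M"
      using GM sets.space_closed by (auto intro!: sets_measure_of space_measure_of)
    have "Z q \<in> borel_measurable ?A" if "q \<in> I" for q
    proof (rule measurableI)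
      fix B :: "real set" assume "B \<in> sets borel"
      \<comment> \<open>A box constrained in the single coordinate \<open>q\<close> is a preimage
        under \<open>Z q\<close>, so every coordinate is measurable for the algebra of
        boxes.\<close>
      hence "R (\<lambda>q'. if q' = q then B else UNIV) \<in> G" by (auto simp: G_def)
      moreover have "R (\<lambda>q'. if q' = q then B else UNIV) = Z q -` B \<inter> space M"
        using \<open>q \<in> I\<close> by (auto simp: R_def split: if_splits)
      ultimately show "Z q -` B \<inter> space ?A \<in> sets ?A" unfolding sA by auto
    qed simp
    hence "x i \<in> borel_measurable ?A" if "i \<in> S" for i
      using that by (intro borel_measurable_vecI) (auto simp: I_def Z_def)
    hence "sets (generated_algebra M x S) \<subseteq> sets ?A"
      by (intro generated_algebra_least sA(2))
    from subsetD[OF this F] show ?thesis by (simp only: sA)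
  qed
  show ?thesis
    by (rule integral_indicator_zero_sigma_sets[OF W W0 Gs GM Gz FG])
qed

text \<open>The events X \<le> \<xi> are stable under intersection, by componentwise infima, and
  generate the sigma-algebra of \<open>X\<close>. Hence E(W | X) = 0 almost surely, and f(X) can be
  pulled out of the conditional expectation.\<close>

lemma integral_mult_zero_of_cdf_zero:
  fixes W :: "'a \<Rightarrow> real" and X :: "'a \<Rightarrow> real^'d"
  assumes W: "integrable M W" and W0: "(\<integral>\<omega>. W \<omega> \<partial>M) = 0"
    and X: "X \<in> borel_measurable M"
    and z: "\<And>\<xi>. (\<integral>\<omega>. indicator {\<omega>\<in>space M. X \<omega> \<le> \<xi>} \<omega> * W \<omega> \<partial>M) = 0"
    and f: "f \<in> borel_measurable borel" and fW: "integrable M (\<lambda>\<omega>. f (X \<omega>) * W \<omega>)"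
  shows "(\<integral>\<omega>. f (X \<omega>) * W \<omega> \<partial>M) = 0"
proof -
  define A where "A = vimage_algebra (space M) X borel"
  have sub: "subalgebra M A"
    using X by (auto simp: subalgebra_def A_def sets_vimage_algebra2 dest: measurable_sets)
  interpret finite_measure_subalgebra M A
    by unfold_locales (rule sub)
  define G where "G = (\<lambda>\<xi>. {\<omega>\<in>space M. X \<omega> \<le> \<xi>}) ` UNIV"
  have "Int_stable G"
  proof (rule Int_stableI)
    fix A A' assume "A \<in> G" "A' \<in> G"
    then obtain a b where "A = {\<omega>\<in>space M. X \<omega> \<le> a}" "A' = {\<omega>\<in>space M. X \<omega> \<le> b}"
      by (auto simp: G_def)
    hence "A \<inter> A' = {\<omega>\<in>space M. X \<omega> \<le> inf a b}" by auto
    thus "A \<inter> A' \<in> G" unfolding G_def by blast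
  qed
  moreover have GM: "G \<subseteq> sets M"
  proof -
    have "X -` {..\<xi>} \<inter> space M \<in> sets M" for \<xi> using X by (auto intro: measurable_sets)
    moreover have "{\<omega>\<in>space M. X \<omega> \<le> \<xi>} = X -` {..\<xi>} \<inter> space M" for \<xi> by auto
    ultimately show ?thesis by (auto simp: G_def)
  qed
  moreover have "sets A \<subseteq> sigma_sets (space M) G"
  proof -
    let ?A = "sigma (space M) G"
    have sA: "sets ?A = sigma_sets (space M) G" "space ?A = space M"
      using GM sets.space_closed by (auto intro!: sets_measure_of space_measure_of)
    have "X \<in> measurable ?A (sigma UNIV (range (\<lambda>a. {..a})))"
    proof (rule measurable_measure_of)
      fix B :: "(real^'d) set" assume "B \<in> range (\<lambda>a. {..a})"
      then obtain a where "B = {..a}" by auto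
      hence "X -` B \<inter> space ?A = {\<omega>\<in>space M. X \<omega> \<le> a}" by (auto simp: sA)
      thus "X -` B \<inter> space ?A \<in> sets ?A" unfolding sA by (auto simp: G_def)
    qed auto
    hence "X \<in> borel_measurable ?A" by (simp add: borel_eq_atMost)
    hence "X -` B \<inter> space M \<in> sigma_sets (space M) G" if "B \<in> sets borel" for B
      using measurable_sets[OF _ that, of X ?A] sA by simp
    thus ?thesis by (auto simp: A_def sets_vimage_algebra2)
  qed
  ultimately have "(\<integral>\<omega>. indicator B \<omega> *\<^sub>R W \<omega> \<partial>M) = 0" if "B \<in> sets A" for B
    using integral_indicator_zero_sigma_sets[OF W W0, of G B] z that by (auto simp: G_def)
  hence "AE \<omega> in M. real_cond_exp M A W \<omega> = 0"
    using W by (intro real_cond_exp_charact) (auto simp: set_lebesgue_integral_def)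
  hence "(\<integral>\<omega>. f (X \<omega>) * real_cond_exp M A W \<omega> \<partial>M) = 0"
    by (intro integral_eq_zero_AE) auto
  moreover have "(\<lambda>\<omega>. f (X \<omega>)) \<in> borel_measurable A"
    using f measurable_vimage_algebra1[of X "space M" borel] unfolding A_def
    by (intro measurable_compose[of X _ borel f]) auto
  ultimately show ?thesis
    using real_cond_exp_intg(2)[OF fW] W by auto
qed

end


section \<open>Second moments and conditional probabilities\<close>

lemma integrable_mult_of_square_integrable:
  fixes f g :: "'a \<Rightarrow> real"
  assumes [measurable]: "f \<in> borel_measurable M" "g \<in> borel_measurable M"
    and "integrable M (\<lambda>\<omega>. (f \<omega>)\<^sup>2)" "integrable M (\<lambda>\<omega>. (g \<omega>)\<^sup>2)"
  shows "integrable M (\<lambda>\<omega>. f \<omega> * g \<omega>)"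
proof (rule Bochner_Integration.integrable_bound)
  show "integrable M (\<lambda>\<omega>. (f \<omega>)\<^sup>2 + (g \<omega>)\<^sup>2)" using assms by simp
  have "\<bar>a * b\<bar> \<le> a\<^sup>2 + b\<^sup>2" for a b :: real
  proof -
    have "2 * (\<bar>a\<bar> * \<bar>b\<bar>) \<le> a\<^sup>2 + b\<^sup>2"
      using sum_squares_bound[of "\<bar>a\<bar>" "\<bar>b\<bar>"] by simp
    moreover have "0 \<le> \<bar>a\<bar> * \<bar>b\<bar>" by simp
    ultimately show ?thesis unfolding abs_mult by linarith
  qed
  thus "AE \<omega> in M. norm (f \<omega> * g \<omega>) \<le> norm ((f \<omega>)\<^sup>2 + (g \<omega>)\<^sup>2)" by simp
qed simp

context prob_space
begin

text \<open>If \<sigma> = 0, \<open>Y\<close> is almost surely constant; otherwise \<open>Y\<close>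
  is standardised. One set of formulas covers both cases, so the later arguments never distinguish
  singular covariances.\<close>

lemma normal_law_imp:
  assumes Y[measurable]: "Y \<in> borel_measurable M" and "0 \<le> \<sigma>"
    and d: "distr M borel Y = normal_law \<mu> \<sigma>"
  shows "integrable M (\<lambda>\<omega>. (Y \<omega>)\<^sup>2)" "expectation Y = \<mu>" "variance Y = \<sigma>\<^sup>2"
    "(\<integral>\<omega>. cis (Y \<omega>) \<partial>M) = cis \<mu> * exp (- \<sigma>\<^sup>2 / 2)"
proof -
  have "integrable M (\<lambda>\<omega>. (Y \<omega>)\<^sup>2) \<and> expectation Y = \<mu> \<and> variance Y = \<sigma>\<^sup>2 \<and>
    (\<integral>\<omega>. cis (Y \<omega>) \<partial>M) = cis \<mu> * exp (- \<sigma>\<^sup>2 / 2)"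
  proof (cases "\<sigma> = 0")
    case True
    have "AE z in distr M borel Y. z = \<mu>"
      unfolding d unfolding normal_law_def using True by (simp add: AE_return)
    hence ae: "AE \<omega> in M. Y \<omega> = \<mu>" by (subst (asm) AE_distr_iff) auto
    have E: "(\<integral>\<omega>. h (Y \<omega>) \<partial>M) = h \<mu>" if [measurable]: "h \<in> borel_measurable borel"
      for h :: "real \<Rightarrow> 'b::{banach,second_countable_topology}"
    proof -
      have "(\<integral>\<omega>. h (Y \<omega>) \<partial>M) = (\<integral>\<omega>. h \<mu> \<partial>M)"
        by (rule integral_cong_AE) (use ae in auto)
      thus ?thesis by (simp add: prob_space)
    qed
    have "integrable M (\<lambda>\<omega>. (Y \<omega>)\<^sup>2) = integrable M (\<lambda>\<omega>. \<mu>\<^sup>2)"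
      by (rule integrable_cong_AE) (use ae in auto)
    moreover have "(\<integral>\<omega>. cis (Y \<omega>) \<partial>M) = cis \<mu>"
      by (rule E) (auto simp: cis_conv_exp)
    moreover have "expectation Y = \<mu>" by (rule E) auto
    moreover have "variance Y = 0" unfolding \<open>expectation Y = \<mu>\<close>
      using E[of "\<lambda>z. (z - \<mu>)\<^sup>2"] by simp
    ultimately show ?thesis using True by simp
  next
    case False
    hence s: "\<sigma> > 0" using assms by simp
    have D: "distributed M lborel Y (\<lambda>t. ennreal (normal_density \<mu> \<sigma> t))"
      using d False Y unfolding distributed_def normal_law_def
      by (simp cong: distr_cong)
    \<comment> \<open>The identity t^2 = (t - \<mu>)^2 + 2 \<mu> t - \<mu>^2 reduces the raw second
      moment to known integrable terms.\<close>
    have "integrable lborel (\<lambda>t. normal_density \<mu> \<sigma> t * (t - \<mu>)\<^sup>2 + (2 * \<mu>) * (normal_density \<mu> \<sigma> t * t)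
        - \<mu>\<^sup>2 * normal_density \<mu> \<sigma> t)"
      using integrable_normal_moment[OF s, of \<mu> 2] integrable_normal_moment_nz_1[OF s]
        integrable_normal_density[OF s] by auto
    also have "(\<lambda>t. normal_density \<mu> \<sigma> t * (t - \<mu>)\<^sup>2 + (2 * \<mu>) * (normal_density \<mu> \<sigma> t * t)
        - \<mu>\<^sup>2 * normal_density \<mu> \<sigma> t) = (\<lambda>t. normal_density \<mu> \<sigma> t * t\<^sup>2)"
      by (auto simp: power2_eq_square algebra_simps)
    finally have 1: "integrable M (\<lambda>\<omega>. (Y \<omega>)\<^sup>2)"
      using distributed_integrable[OF D, of "\<lambda>t. t\<^sup>2"] by simp
    have "distributed M lborel (\<lambda>\<omega>. (Y \<omega> - \<mu>) / \<sigma>) (\<lambda>t. ennreal (std_normal_density t))"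
      using normal_standard_normal_convert[OF s] D by blast
    hence Z: "distr M lborel (\<lambda>\<omega>. (Y \<omega> - \<mu>) / \<sigma>) = std_normal_distribution"
      by (simp add: distributed_def)
    \<comment> \<open>At frequency \<sigma> the standardised variable becomes Y - \<mu>.\<close>
    have "exp (- (\<sigma>\<^sup>2) / 2) = char std_normal_distribution \<sigma>"
      by (simp add: char_std_normal_distribution)
    also have "\<dots> = (\<integral>\<omega>. cis (\<sigma> * ((Y \<omega> - \<mu>) / \<sigma>)) \<partial>M)"
      unfolding char_def Z[symmetric] by (subst integral_distr) (auto simp: cis_conv_exp)
    also have "\<dots> = (\<integral>\<omega>. cis (- \<mu>) * cis (Y \<omega>) \<partial>M)"
      using s by (simp add: cis_mult)
    finally have "cis \<mu> * exp (- (\<sigma>\<^sup>2) / 2) = cis \<mu> * (cis (- \<mu>) * (\<integral>\<omega>. cis (Y \<omega>) \<partial>M))"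
      by simp
    hence "(\<integral>\<omega>. cis (Y \<omega>) \<partial>M) = cis \<mu> * exp (- \<sigma>\<^sup>2 / 2)"
      by (simp add: mult.assoc[symmetric] cis_mult)
    with 1 normal_distributed_expectation[OF s D] normal_distributed_variance[OF s D]
    show ?thesis by blast
  qed
  thus "integrable M (\<lambda>\<omega>. (Y \<omega>)\<^sup>2)" "expectation Y = \<mu>" "variance Y = \<sigma>\<^sup>2"
    "(\<integral>\<omega>. cis (Y \<omega>) \<partial>M) = cis \<mu> * exp (- \<sigma>\<^sup>2 / 2)" by blast+
qed

text \<open>This is the normal equation R G = B for the regression coefficients R = B G^+, valid for
  a singular Gram matrix \<open>G\<close>: since G G^+ G = G, the vector w - G^+ G w lies in the
  kernel of \<open>G\<close>, and that kernel is contained in the kernel of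
  \<open>B\<close>.\<close>

lemma cross_moment_moore_penrose:
  fixes \<zeta> :: "'q::finite \<Rightarrow> 'a \<Rightarrow> real" and \<eta> :: "'m::finite \<Rightarrow> 'a \<Rightarrow> real"
    and G :: "real^'q^'q" and B :: "real^'q^'m"
  assumes [measurable]: "\<And>q. \<zeta> q \<in> borel_measurable M" "\<And>a. \<eta> a \<in> borel_measurable M"
    and sq: "\<And>q. integrable M (\<lambda>\<omega>. (\<zeta> q \<omega>)\<^sup>2)" "\<And>a. integrable M (\<lambda>\<omega>. (\<eta> a \<omega>)\<^sup>2)"
    and G: "\<And>q r. G $ q $ r = (\<integral>\<omega>. \<zeta> q \<omega> * \<zeta> r \<omega> \<partial>M)"
    and B: "\<And>a q. B $ a $ q = (\<integral>\<omega>. \<eta> a \<omega> * \<zeta> q \<omega> \<partial>M)"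
  shows "B ** moore_penrose G ** G = B"
proof -
  have [simp]: "integrable M (\<lambda>\<omega>. \<zeta> q \<omega> * \<zeta> r \<omega>)" "integrable M (\<lambda>\<omega>. \<eta> a \<omega> * \<zeta> q \<omega>)" for q r a
    using sq by (auto intro: integrable_mult_of_square_integrable)
  \<comment> \<open>If \<open>G w = 0\<close> then \<open>\<Sum>q. w q * \<zeta> q\<close> has second moment zero, hence vanishes almost surely.\<close>
  have ker: "B *v w = 0" if w: "G *v w = 0" for w
  proof -
    define z where "z = (\<lambda>\<omega>. \<Sum>q\<in>UNIV. w $ q * \<zeta> q \<omega>)"
    have [measurable]: "z \<in> borel_measurable M" by (simp add: z_def)
    have z2: "(z \<omega>)\<^sup>2 = (\<Sum>q\<in>UNIV. \<Sum>r\<in>UNIV. w $ q * w $ r * (\<zeta> q \<omega> * \<zeta> r \<omega>))" for \<omega>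
      by (simp add: z_def power2_eq_square sum_product mult_ac)
    have "(\<integral>\<omega>. (z \<omega>)\<^sup>2 \<partial>M) = (\<Sum>q\<in>UNIV. w $ q * (\<Sum>r\<in>UNIV. G $ q $ r * w $ r))"
      unfolding z2 by (simp add: G sum_distrib_left mult_ac)
    also have "\<dots> = w \<bullet> (G *v w)" by (simp add: inner_vec_def matrix_vector_mult_def)
    finally have "(\<integral>\<omega>. (z \<omega>)\<^sup>2 \<partial>M) = 0" using w by simp
    moreover have "integrable M (\<lambda>\<omega>. (z \<omega>)\<^sup>2)" unfolding z2 by simp
    ultimately have "AE \<omega> in M. z \<omega> = 0"
      by (subst (asm) integral_nonneg_eq_0_iff_AE) auto
    hence "(\<integral>\<omega>. \<eta> a \<omega> * z \<omega> \<partial>M) = 0" for a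
      by (intro integral_eq_zero_AE) auto
    moreover have "\<eta> a \<omega> * z \<omega> = (\<Sum>q\<in>UNIV. w $ q * (\<eta> a \<omega> * \<zeta> q \<omega>))" for a \<omega>
      by (simp add: z_def sum_distrib_left mult_ac)
    ultimately show ?thesis
      by (simp add: vec_eq_iff matrix_vector_mult_def B mult_ac)
  qed
  have "(B ** moore_penrose G ** G) *v w = B *v w" for w
  proof -
    have "G *v (w - moore_penrose G *v (G *v w)) = 0"
      using is_moore_penrose_moore_penrose[of G]
      by (simp add: is_moore_penrose_def matrix_vector_mult_diff_distrib matrix_vector_mul_assoc matrix_mul_assoc)
    from ker[OF this] show ?thesis
      by (simp add: matrix_vector_mult_diff_distrib matrix_vector_mul_assoc matrix_mul_assoc)
  qed
  thus ?thesis by (simp add: matrix_eq)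
qed

text \<open>Pulling the \<open>T\<close>-measurable \<open>f\<close> out of the conditional
  expectation gives E(P(F | T) f) = E(f; F). The second claim records the integrability that this
  needs.\<close>

lemma integral_centered_cond_prob_zero:
  fixes f :: "'a \<Rightarrow> real"
  assumes T: "subalgebra M T" and F: "F \<in> sets M"
    and f: "f \<in> borel_measurable T" "integrable M f"
  shows "(\<integral>\<omega>. (indicator F \<omega> - real_cond_exp M T (indicator F) \<omega>) * f \<omega> \<partial>M) = 0"
    and "integrable M (\<lambda>\<omega>. real_cond_exp M T (indicator F) \<omega> * f \<omega>)"
proof -
  interpret finite_measure_subalgebra M T by unfold_locales (rule T)
  have i: "integrable M (\<lambda>\<omega>. f \<omega> * indicator F \<omega>)"
    using integrable_mult_indicator[OF F f(2)] by (simp add: mult_ac)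
  note intg = real_cond_exp_intg[OF i f(1)] 
  have m: "indicator F \<in> borel_measurable M" using F by simp
  show "integrable M (\<lambda>\<omega>. real_cond_exp M T (indicator F) \<omega> * f \<omega>)"
    using intg(1)[OF m] by (simp add: mult_ac)
  thus "(\<integral>\<omega>. (indicator F \<omega> - real_cond_exp M T (indicator F) \<omega>) * f \<omega> \<partial>M) = 0"
    using intg(2)[OF m] i by (simp add: right_diff_distrib mult.commute[of _ "f _"])
qed

text \<open>Conditional expectation is self-adjoint: E(1_D P(F | T)) = E(P(D | T) 1_F). So the
  integral on the right is E(1_D; F) - E(P(D | T); F), and its vanishing for all \<open>F\<close> in
  \<open>S\<close> characterises P(D | T) as a version of P(D | S).\<close>

lemma real_cond_exp_indicator_eq_iff:
  assumes S: "subalgebra M S" and T: "subalgebra M T" and TS: "sets T \<subseteq> sets S"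
    and D: "D \<in> sets M"
  shows "(AE \<omega> in M. real_cond_exp M S (indicator D) \<omega> = real_cond_exp M T (indicator D) \<omega>) \<longleftrightarrow>
    (\<forall>F\<in>sets S. (\<integral>\<omega>. indicator D \<omega> * (indicator F \<omega> - real_cond_exp M T (indicator F) \<omega>) \<partial>M) = 0)"
proof -
  interpret S: finite_measure_subalgebra M S by unfold_locales (rule S)
  interpret T: finite_measure_subalgebra M T by unfold_locales (rule T)
  have iD: "integrable M (indicator D :: 'a \<Rightarrow> real)" using D by (simp add: emeasure_eq_measure)
  have key: "(\<integral>\<omega>. indicator D \<omega> * (indicator F \<omega> - real_cond_exp M T (indicator F) \<omega>) \<partial>M)
      = (\<integral>\<omega>\<in>F. indicator D \<omega> \<partial>M) - (\<integral>\<omega>\<in>F. real_cond_exp M T (indicator D) \<omega> \<partial>M)"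
    if "F \<in> sets S" for F
  proof -
    have F: "F \<in> sets M" using that S by (auto simp: subalgebra_def)
    have iF: "integrable M (indicator F :: 'a \<Rightarrow> real)" using F by (simp add: emeasure_eq_measure)
    have 1: "integrable M (\<lambda>\<omega>. real_cond_exp M T (indicator F) \<omega> * indicator D \<omega>)"
      using integrable_mult_indicator[OF D T.real_cond_exp_int(1)[OF iF]] by (simp add: mult_ac)
    have 2: "integrable M (\<lambda>\<omega>. real_cond_exp M T (indicator D) \<omega> * indicator F \<omega>)"
      using integrable_mult_indicator[OF F T.real_cond_exp_int(1)[OF iD]] by (simp add: mult_ac)
    have "(\<integral>\<omega>. real_cond_exp M T (indicator F) \<omega> * indicator D \<omega> \<partial>M)
        = (\<integral>\<omega>. real_cond_exp M T (indicator F) \<omega> * real_cond_exp M T (indicator D) \<omega> \<partial>M)"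
      by (rule T.real_cond_exp_intg(2)[symmetric]) (use 1 D in auto)
    also have "\<dots> = (\<integral>\<omega>. real_cond_exp M T (indicator D) \<omega> * indicator F \<omega> \<partial>M)"
      by (subst T.real_cond_exp_intg(2)[symmetric]) (use 2 F in \<open>auto simp: mult.commute\<close>)
    finally have "(\<integral>\<omega>. real_cond_exp M T (indicator F) \<omega> * indicator D \<omega> \<partial>M) = \<dots>" .
    moreover have "integrable M (\<lambda>\<omega>. indicator D \<omega> * indicator F \<omega> :: real)"
      using integrable_mult_indicator[OF D iF] by simp
    ultimately show ?thesis
      using 1 by (simp add: right_diff_distrib set_lebesgue_integral_def mult.commute)
  qed
  show ?thesis
  proof
    assume ae: "AE \<omega> in M. real_cond_exp M S (indicator D) \<omega> = real_cond_exp M T (indicator D) \<omega>"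
    show "\<forall>F\<in>sets S. (\<integral>\<omega>. indicator D \<omega> * (indicator F \<omega> - real_cond_exp M T (indicator F) \<omega>) \<partial>M) = 0"
    proof
      fix F assume F: "F \<in> sets S"
      hence FM: "F \<in> sets M" using S by (auto simp: subalgebra_def)
      have "(\<integral>\<omega>\<in>F. indicator D \<omega> \<partial>M) = (\<integral>\<omega>\<in>F. real_cond_exp M S (indicator D) \<omega> \<partial>M)"
        by (rule S.real_cond_exp_intA[OF iD F])
      also have "\<dots> = (\<integral>\<omega>\<in>F. real_cond_exp M T (indicator D) \<omega> \<partial>M)"
        unfolding set_lebesgue_integral_def using ae FM by (intro integral_cong_AE) auto
      finally show "(\<integral>\<omega>. indicator D \<omega> * (indicator F \<omega> - real_cond_exp M T (indicator F) \<omega>) \<partial>M) = 0"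
        using key[OF F] by simp
    qed
  next
    assume "\<forall>F\<in>sets S. (\<integral>\<omega>. indicator D \<omega> * (indicator F \<omega> - real_cond_exp M T (indicator F) \<omega>) \<partial>M) = 0"
    moreover have "subalgebra S T" using S T TS by (auto simp: subalgebra_def)
    hence "real_cond_exp M T (indicator D) \<in> borel_measurable S"
      by (rule measurable_from_subalg) simp
    ultimately show "AE \<omega> in M. real_cond_exp M S (indicator D) \<omega> = real_cond_exp M T (indicator D) \<omega>"
      using key iD by (intro S.real_cond_exp_charact) auto
  qed
qed

end


section \<open>Gaussian sequences and regression residuals\<close>

locale gaussian_seq = prob_space M for M :: "'a measure" +
  fixes N :: nat and x :: "nat \<Rightarrow> 'a \<Rightarrow> real^'d"
  assumes gaussian: "gaussian_sequence M N x"
begin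

definition lin :: "(nat \<Rightarrow> real^'d) \<Rightarrow> 'a \<Rightarrow> real" where
  "lin p \<omega> = (\<Sum>k\<in>{0..N}. p k \<bullet> x k \<omega>)"

definition centered :: "nat \<Rightarrow> 'a \<Rightarrow> real^'d" where
  "centered k \<omega> = x k \<omega> - integral\<^sup>L M (x k)"

lemma x_measurable [measurable]: "k \<le> N \<Longrightarrow> x k \<in> borel_measurable M"
  using gaussian by (simp add: gaussian_sequence_def)

lemma lin_measurable [measurable]: "lin p \<in> borel_measurable M"
  unfolding lin_def by (intro borel_measurable_sum borel_measurable_inner) auto

lemma lin_square_integrable: "integrable M (\<lambda>\<omega>. (lin p \<omega>)\<^sup>2)"
  and char_lin: "(\<integral>\<omega>. cis (lin p \<omega>) \<partial>M) = cis (expectation (lin p)) * exp (- variance (lin p) / 2)"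
proof -
  obtain \<mu> \<sigma> where s: "0 \<le> \<sigma>" and d: "distr M borel (lin p) = normal_law \<mu> \<sigma>"
    using gaussian unfolding gaussian_sequence_def lin_def[abs_def] by blast
  note n = normal_law_imp[OF lin_measurable s d]
  show "integrable M (\<lambda>\<omega>. (lin p \<omega>)\<^sup>2)" by (rule n)
  show "(\<integral>\<omega>. cis (lin p \<omega>) \<partial>M) = cis (expectation (lin p)) * exp (- variance (lin p) / 2)"
    using n by simp
qed

lemma lin_integrable: "integrable M (lin p)"
  by (rule square_integrable_imp_integrable[OF lin_measurable lin_square_integrable])

lemma component_eq_lin:
  assumes "k \<le> N"
  shows "x k \<omega> $ a = lin (\<lambda>i. if i = k then axis a 1 else 0) \<omega>"
proof -
  have "lin (\<lambda>i. if i = k then axis a 1 else 0) \<omega> = (\<Sum>i\<in>{0..N}. if i = k then axis a 1 \<bullet> x i \<omega> else 0)"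
    unfolding lin_def by (intro sum.cong) auto
  thus ?thesis using assms by (simp add: inner_axis' )
qed

lemma component_integrable: "k \<le> N \<Longrightarrow> integrable M (\<lambda>\<omega>. x k \<omega> $ a)"
  using lin_integrable by (simp add: component_eq_lin)

lemma component_square_integrable: "k \<le> N \<Longrightarrow> integrable M (\<lambda>\<omega>. (x k \<omega> $ a)\<^sup>2)"
  using lin_square_integrable by (simp add: component_eq_lin)

lemma x_integrable: "k \<le> N \<Longrightarrow> integrable M (x k)"
proof (rule Bochner_Integration.integrable_bound)
  assume k: "k \<le> N"
  show "integrable M (\<lambda>\<omega>. \<Sum>a\<in>UNIV. \<bar>x k \<omega> $ a\<bar>)"
    using component_integrable[OF k] by auto
  show "AE \<omega> in M. norm (x k \<omega>) \<le> norm (\<Sum>a\<in>UNIV. \<bar>x k \<omega> $ a\<bar>)"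
    using norm_le_l1_cart[of "x k _"] by (auto simp: sum_nonneg)
qed simp

lemma centered_component: "k \<le> N \<Longrightarrow> centered k \<omega> $ a = x k \<omega> $ a - (\<integral>\<omega>. x k \<omega> $ a \<partial>M)"
  using integral_bounded_linear[OF bounded_linear_vec_nth x_integrable, of k a]
  by (simp add: centered_def)

lemma centered_measurable [measurable]: "k \<le> N \<Longrightarrow> centered k \<in> borel_measurable M"
  unfolding centered_def[abs_def] by simp

lemma centered_component_measurable [measurable]: "k \<le> N \<Longrightarrow> (\<lambda>\<omega>. centered k \<omega> $ a) \<in> borel_measurable M"
  by simp

lemma centered_integrable: "k \<le> N \<Longrightarrow> integrable M (\<lambda>\<omega>. centered k \<omega> $ a)"
  using component_integrable by (simp add: centered_component)

lemma centered_square_integrable: "k \<le> N \<Longrightarrow> integrable M (\<lambda>\<omega>. (centered k \<omega> $ a)\<^sup>2)"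
  using component_integrable component_square_integrable
  by (simp add: centered_component power2_diff)

lemma centered_mult_integrable: "k \<le> N \<Longrightarrow> i \<le> N \<Longrightarrow> integrable M (\<lambda>\<omega>. centered k \<omega> $ a * centered i \<omega> $ b)"
  by (intro integrable_mult_of_square_integrable centered_square_integrable) auto

lemma cov_matrix_centered: "cov_matrix M (x k) (x i) $ a $ b = (\<integral>\<omega>. centered k \<omega> $ a * centered i \<omega> $ b \<partial>M)"
  by (simp add: cov_matrix_def centered_def)

lemma lin_centered: "lin p \<omega> - expectation (lin p) = (\<Sum>k\<in>{0..N}. p k \<bullet> centered k \<omega>)"
proof -
  have "expectation (lin p) = (\<Sum>k\<in>{0..N}. p k \<bullet> integral\<^sup>L M (x k))"
    unfolding lin_def[abs_def] using x_integrable
    by (subst Bochner_Integration.integral_sum) (auto intro!: sum.cong integral_inner_right)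
  thus ?thesis by (simp add: lin_def centered_def inner_diff_right sum_subtractf)
qed

text \<open>Zero covariance makes variances additive, so the characteristic function of s * lin p +
  lin q factors for every \<open>q\<close> supported in \<open>S\<close>. Two applications of
  Fourier uniqueness, first for the variables in \<open>S\<close> and then for \<open>lin p\<close>,
  turn this into the product rule for events.\<close>

lemma indep_of_uncorrelated:
  assumes S: "S \<subseteq> {0..N}"
    and cov: "\<And>i b. i \<in> S \<Longrightarrow> (\<integral>\<omega>. (lin p \<omega> - expectation (lin p)) * centered i \<omega> $ b \<partial>M) = 0"
    and f: "f \<in> measurable borel K"
    and V: "V \<in> measurable (generated_algebra M x S) L"
  shows "indep_var K (\<lambda>\<omega>. f (lin p \<omega>)) L V"
proof -
  have finS: "finite S" using S finite_subset by blast
  have xS: "x i \<in> borel_measurable M" if "i \<in> S" for i using that S by auto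
  have sub: "subalgebra M (generated_algebra M x S)"
    using xS by (rule subalgebra_generated_algebra)
  define \<phi> where "\<phi> s = (\<integral>\<omega>. cis (s * lin p \<omega>) \<partial>M)" for s
  have cb: "integrable M (\<lambda>\<omega>. cis (f \<omega>))" if [measurable]: "f \<in> borel_measurable M" for f :: "'a \<Rightarrow> real"
    by (rule integrable_const_bound[of _ 1]) (auto simp: cis_conv_exp)
  have factor: "(\<integral>\<omega>. cis (s * lin p \<omega> + lin q \<omega>) \<partial>M) = \<phi> s * (\<integral>\<omega>. cis (lin q \<omega>) \<partial>M)"
    if q: "\<And>i. i \<notin> S \<Longrightarrow> q i = 0" for s q
  proof -
    define r where "r = (\<lambda>i. s *\<^sub>R p i + q i)"
    have lr: "lin r \<omega> = s * lin p \<omega> + lin q \<omega>" and lsp: "lin (\<lambda>i. s *\<^sub>R p i) \<omega> = s * lin p \<omega>" for \<omega>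
      by (auto simp: lin_def r_def inner_add_left sum.distrib sum_distrib_left)
    have Er: "expectation (lin r) = s * expectation (lin p) + expectation (lin q)"
      unfolding lr[abs_def] using lin_integrable by simp
    have Esp: "expectation (lin (\<lambda>i. s *\<^sub>R p i)) = s * expectation (lin p)"
      unfolding lsp[abs_def] by simp
    let ?P = "\<lambda>\<omega>. lin p \<omega> - expectation (lin p)" and ?Q = "\<lambda>\<omega>. lin q \<omega> - expectation (lin q)"
    have sqc: "integrable M (\<lambda>\<omega>. (lin p \<omega> - expectation (lin p))\<^sup>2)" for p
      using lin_integrable lin_square_integrable by (simp add: power2_diff)
    have i1: "integrable M (\<lambda>\<omega>. ?P \<omega> * centered i \<omega> $ b)" if "i \<le> N" for i b
      using that sqc by (intro integrable_mult_of_square_integrable centered_square_integrable) auto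
    have "(\<integral>\<omega>. ?P \<omega> * ?Q \<omega> \<partial>M) = (\<integral>\<omega>. (\<Sum>i\<in>{0..N}. \<Sum>b\<in>UNIV. q i $ b * (?P \<omega> * centered i \<omega> $ b)) \<partial>M)"
      unfolding lin_centered[of q]
      by (simp add: inner_vec_def sum_distrib_left mult_ac)
    also have "\<dots> = (\<Sum>i\<in>{0..N}. \<Sum>b\<in>UNIV. q i $ b * (\<integral>\<omega>. ?P \<omega> * centered i \<omega> $ b \<partial>M))"
      using i1 by simp
    also have "\<dots> = 0"
    \<comment> \<open>Each term dies either because \<open>q\<close> vanishes outside
      \<open>S\<close> or because of the covariance hypothesis on \<open>S\<close>.\<close>
    proof (intro sum.neutral ballI)
      fix i b
      show "q i $ b * (\<integral>\<omega>. ?P \<omega> * centered i \<omega> $ b \<partial>M) = 0"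
        using cov[of i b] q[of i] by (cases "i \<in> S") auto
    qed
    finally have PQ: "(\<integral>\<omega>. ?P \<omega> * ?Q \<omega> \<partial>M) = 0" .
    have "(lin r \<omega> - expectation (lin r))\<^sup>2 = s\<^sup>2 * (?P \<omega>)\<^sup>2 + (?Q \<omega>)\<^sup>2 + (2 * s) * (?P \<omega> * ?Q \<omega>)" for \<omega>
      unfolding lr Er by (simp add: power2_eq_square algebra_simps)
    moreover have "integrable M (\<lambda>\<omega>. ?P \<omega> * ?Q \<omega>)"
      using sqc by (intro integrable_mult_of_square_integrable) auto
    ultimately have Vr: "variance (lin r) = s\<^sup>2 * variance (lin p) + variance (lin q)"
      using sqc PQ by simp
    have Vsp: "variance (lin (\<lambda>i. s *\<^sub>R p i)) = s\<^sup>2 * variance (lin p)"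
      unfolding Esp lsp
      by (simp add: right_diff_distrib[symmetric] power_mult_distrib)
    have e: "exp (- (u + v) / 2) = exp (- u / 2) * exp (- v / 2)" for u v :: real
      by (simp add: exp_add[symmetric] field_simps)
    show ?thesis
      using char_lin[of r] char_lin[of "\<lambda>i. s *\<^sub>R p i"] char_lin[of q]
      unfolding Vr Vsp unfolding lr lsp Er Esp e \<phi>_def by (simp add: cis_mult[symmetric])
  qed
  have zero: "(\<integral>\<omega>. indicator F \<omega> *\<^sub>R (cis (s * lin p \<omega>) - \<phi> s) \<partial>M) = 0"
    if F: "F \<in> sets (generated_algebra M x S)" for F s
  proof (rule integral_zero_generated_algebra_of_char_zero[OF finS xS _ _ F])
    show "integrable M (\<lambda>\<omega>. cis (s * lin p \<omega>) - \<phi> s)" by (auto intro!: cb)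
  next
    fix q :: "nat \<Rightarrow> real^'d"
    \<comment> \<open>Extension by zero turns a functional of the variables in \<open>S\<close> into
      one of the whole sequence.\<close>
    define q' where "q' = (\<lambda>i. if i \<in> S then q i else 0)"
    have "lin q' \<omega> = (\<Sum>i\<in>{0..N}. if i \<in> S then q i \<bullet> x i \<omega> else 0)" for \<omega>
      unfolding lin_def q'_def by (intro sum.cong) auto
    hence "lin q' \<omega> = (\<Sum>i\<in>S. q i \<bullet> x i \<omega>)" for \<omega>
      using S by (simp add: sum.inter_restrict[symmetric] Int_absorb1)
    moreover have "(cis (s * lin p \<omega>) - \<phi> s) * cis (lin q' \<omega>)
        = cis (s * lin p \<omega> + lin q' \<omega>) - \<phi> s * cis (lin q' \<omega>)" for \<omega>
      by (simp add: cis_mult left_diff_distrib)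
    ultimately have "(\<integral>\<omega>. (cis (s * lin p \<omega>) - \<phi> s) * cis (\<Sum>i\<in>S. q i \<bullet> x i \<omega>) \<partial>M)
        = (\<integral>\<omega>. cis (s * lin p \<omega> + lin q' \<omega>) - \<phi> s * cis (lin q' \<omega>) \<partial>M)"
      by simp
    also have "\<dots> = 0"
      using factor[of q' s] by (subst Bochner_Integration.integral_diff) (auto simp: q'_def intro!: cb)
    finally show "(\<integral>\<omega>. (cis (s * lin p \<omega>) - \<phi> s) * cis (\<Sum>i\<in>S. q i \<bullet> x i \<omega>) \<partial>M) = 0" .
  qed
  have prod: "prob ((lin p -` B \<inter> space M) \<inter> F) = prob (lin p -` B \<inter> space M) * prob F"
    if F: "F \<in> sets (generated_algebra M x S)" and B[measurable]: "B \<in> sets borel" for F B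
  proof -
    have [measurable]: "F \<in> sets M" using F sub by (auto simp: subalgebra_def)
    \<comment> \<open>The roles are exchanged: now the centred indicator of \<open>F\<close> is the
      weight, and \<open>zero\<close> says that its transform against \<open>lin p\<close>
      vanishes.\<close>
    have "(\<integral>\<omega>. (indicator F \<omega> - prob F) * indicator B (lin p \<omega>) \<partial>M) = 0"
    proof (rule indicator_integral_zero_of_char_zero_real)
      fix t
      have iF: "integrable M (\<lambda>\<omega>. indicator F \<omega> *\<^sub>R cis (t * lin p \<omega>))"
        by (intro integrable_mult_indicator cb) auto
      have "indicator F \<omega> *\<^sub>R (cis (t * lin p \<omega>) - \<phi> t)
          = indicator F \<omega> *\<^sub>R cis (t * lin p \<omega>) - indicator F \<omega> *\<^sub>R \<phi> t" for \<omega>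
        by (simp add: scaleR_diff_right)
      with zero[OF F, of t] iF have "(\<integral>\<omega>. indicator F \<omega> *\<^sub>R cis (t * lin p \<omega>) \<partial>M) = prob F * \<phi> t"
        by (simp add: emeasure_eq_measure scaleR_conv_of_real)
      moreover have "complex_of_real (indicator F \<omega> - prob F) * cis (t * lin p \<omega>)
         = indicator F \<omega> *\<^sub>R cis (t * lin p \<omega>) - prob F * cis (t * lin p \<omega>)" for \<omega>
        by (simp add: scaleR_conv_of_real left_diff_distrib)
      ultimately show "(\<integral>\<omega>. complex_of_real (indicator F \<omega> - prob F) * cis (t * lin p \<omega>) \<partial>M) = 0"
        using iF by (simp add: cb \<phi>_def)
    qed (auto simp: emeasure_eq_measure)
    moreover have "(indicator F \<omega> - prob F) * indicator B (lin p \<omega>)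
      = indicator ((lin p -` B \<inter> space M) \<inter> F) \<omega> - prob F * indicator (lin p -` B \<inter> space M) \<omega>"
      if "\<omega> \<in> space M" for \<omega>
      using that by (auto split: split_indicator)
    ultimately have "(\<integral>\<omega>. indicator ((lin p -` B \<inter> space M) \<inter> F) \<omega> - prob F * indicator (lin p -` B \<inter> space M) \<omega> \<partial>M) = 0"
      by (simp cong: Bochner_Integration.integral_cong)
    thus ?thesis
      by (subst (asm) Bochner_Integration.integral_diff) (auto simp: emeasure_eq_measure mult.commute)
  qed
  have VM: "V \<in> measurable M L" by (rule measurable_from_subalg[OF sub V])
  have fM: "(\<lambda>\<omega>. f (lin p \<omega>)) \<in> measurable M K"
    using lin_measurable f by (rule measurable_compose)
  \<comment> \<open>Preimages of a sigma-algebra already form one, so independence is literally the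
    product rule for preimages.\<close>
  have s1: "sigma_sets (space M) {(\<lambda>\<omega>. f (lin p \<omega>)) -` A \<inter> space M |A. A \<in> sets K}
      = {(\<lambda>\<omega>. f (lin p \<omega>)) -` A \<inter> space M |A. A \<in> sets K}"
    using sets_vimage_algebra2[of _ "space M" K] sets_vimage_algebra[of "space M" _ K] fM
    by (simp add: measurable_def)
  have s2: "sigma_sets (space M) {V -` A \<inter> space M |A. A \<in> sets L} = {V -` A \<inter> space M |A. A \<in> sets L}"
    using sets_vimage_algebra2[of V "space M" L] sets_vimage_algebra[of "space M" V L] VM
    by (simp add: measurable_def)
  have VF: "V -` A \<inter> space M \<in> sets (generated_algebra M x S)" if "A \<in> sets L" for A
    using measurable_sets[OF V that] by simp
  have fB: "f -` A \<in> sets borel" if "A \<in> sets K" for A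
    using measurable_sets[OF f that] by simp
  have "prob (((\<lambda>\<omega>. f (lin p \<omega>)) -` A \<inter> space M) \<inter> (V -` A' \<inter> space M))
      = prob ((\<lambda>\<omega>. f (lin p \<omega>)) -` A \<inter> space M) * prob (V -` A' \<inter> space M)"
    if "A \<in> sets K" "A' \<in> sets L" for A A'
    using prod[OF VF[OF that(2)] fB[OF that(1)]] by (simp add: vimage_def)
  thus ?thesis
    unfolding indep_var_eq s1 s2 indep_sets2_eq
    using VM fM measurable_sets[OF VM] measurable_sets[OF fM] by blast
qed

end

lemma sum_UNIV_Plus:
  fixes f :: "'b::finite + 'c::finite \<Rightarrow> 'e::comm_monoid_add"
  shows "(\<Sum>q\<in>UNIV. f q) = (\<Sum>l\<in>UNIV. f (Inl l)) + (\<Sum>l\<in>UNIV. f (Inr l))"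
  unfolding UNIV_Plus_UNIV[symmetric] by (subst sum.Plus) (auto simp: comp_def)

context gaussian_seq
begin

text \<open>The heart of the equivalence for one pair \<open>j\<close>, \<open>k\<close>. The
  conditioning set \<open>S\<close> is left general and later becomes
  \<open>{0..j} \<union> {c}\<close>; the indices \<open>j\<close> and \<open>c\<close> drop out on
  the right because the normal equations settle them.\<close>

lemma cond_cdf_eq_iff:
  fixes C :: "nat \<Rightarrow> nat \<Rightarrow> real^'d^'d"
  assumes le: "j \<le> N" "k \<le> N" "c \<le> N" and S: "S \<subseteq> {0..N}" "j \<in> S" "c \<in> S"
    and C: "\<And>k i. k \<le> N \<Longrightarrow> i \<le> N \<Longrightarrow> C k i = cov_matrix M (x k) (x i)"
  shows "(\<forall>\<xi>. AE \<omega> in M. cond_cdf M (x k) x S \<xi> \<omega> = cond_cdf M (x k) x {j, c} \<xi> \<omega>) \<longleftrightarrow>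
    (\<forall>i\<in>S - {j, c}. C k i =
         hblock (C k j) (C k c)
         ** moore_penrose (vblock (hblock (C j j) (C j c))
                                  (hblock (C c j) (C c c)))
         ** vblock (C j i) (C c i))"
proof -
  define B where "B = hblock (C k j) (C k c)"
  define G where "G = vblock (hblock (C j j) (C j c)) (hblock (C c j) (C c c))"
  define R where "R = B ** moore_penrose G"
  define D where "D i = vblock (C j i) (C c i)" for i
  \<comment> \<open>The stacked centred regressors: \<open>G\<close> is their Gram matrix,
    \<open>B\<close> and \<open>D i\<close> are their cross moments with \<open>x k\<close> and
    \<open>x i\<close>.\<close>
  define \<zeta> where "\<zeta> q \<omega> = (case q of Inl l \<Rightarrow> centered j \<omega> $ l | Inr l \<Rightarrow> centered c \<omega> $ l)" for q \<omega>
  define u where "u a \<omega> = centered k \<omega> $ a - (\<Sum>q\<in>UNIV. R $ a $ q * \<zeta> q \<omega>)" for a \<omega>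
  \<comment> \<open>\<alpha> and \<beta> are the two halves of R^T s, the coefficients of
    \<open>x j\<close> and \<open>x c\<close> in the prediction of s . x_k.\<close>
  define \<alpha> where "\<alpha> s = (\<chi> l. \<Sum>a\<in>UNIV. s $ a * R $ a $ Inl l)" for s :: "real^'d"
  define \<beta> where "\<beta> s = (\<chi> l. \<Sum>a\<in>UNIV. s $ a * R $ a $ Inr l)" for s :: "real^'d"
  \<comment> \<open>\<open>u\<close> is the residual of the regression of \<open>x k\<close> on \<open>x j, x c\<close>, and \<open>p s\<close> represents
    \<open>s \<bullet> u\<close>, up to a constant, as a linear functional of the sequence; written with differences
    so that coincidences among \<open>j, k, c\<close> need no case distinction.\<close>
  define p where "p s i = (if i = k then s else 0) - (if i = j then \<alpha> s else 0) - (if i = c then \<beta> s else 0)"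
    for s and i :: nat

  \<comment> \<open>Moments of the regressors and of the residual\<close>
  have iS: "i \<le> N" if "i \<in> S" for i using that S by auto
  have zm[measurable]: "\<zeta> q \<in> borel_measurable M" for q
    unfolding \<zeta>_def[abs_def] using le by (cases q) auto
  have zsq: "integrable M (\<lambda>\<omega>. (\<zeta> q \<omega>)\<^sup>2)" for q
    unfolding \<zeta>_def[abs_def] using le centered_square_integrable by (cases q) auto
  have zi: "integrable M (\<zeta> q)" for q
    by (rule square_integrable_imp_integrable[OF zm zsq])
  have zyi: "integrable M (\<lambda>\<omega>. \<zeta> q \<omega> * centered i \<omega> $ b)" if "i \<le> N" for q i b
    using that zsq by (intro integrable_mult_of_square_integrable centered_square_integrable) auto
  have Bz: "B $ a $ q = (\<integral>\<omega>. centered k \<omega> $ a * \<zeta> q \<omega> \<partial>M)" for a q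
    using le by (cases q) (auto simp: B_def hblock_def C cov_matrix_centered \<zeta>_def)
  have Dz: "D i $ q $ b = (\<integral>\<omega>. \<zeta> q \<omega> * centered i \<omega> $ b \<partial>M)" if "i \<le> N" for i q b
    using le that by (cases q) (auto simp: D_def vblock_def C cov_matrix_centered \<zeta>_def)
  have Gz: "G $ q $ r = (\<integral>\<omega>. \<zeta> q \<omega> * \<zeta> r \<omega> \<partial>M)" for q r
    using le by (cases q; cases r) (auto simp: G_def vblock_def hblock_def C cov_matrix_centered \<zeta>_def)
  have RG: "R ** G = B"
    unfolding R_def
    by (rule cross_moment_moore_penrose[of \<zeta> "\<lambda>a \<omega>. centered k \<omega> $ a"])
      (use le zsq Gz Bz centered_square_integrable in auto)
  have ui: "integrable M (u a)" for a
    unfolding u_def[abs_def] using le zi centered_integrable by auto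
  have uyi: "integrable M (\<lambda>\<omega>. u a \<omega> * centered i \<omega> $ b)" if "i \<le> N" for a i b
    unfolding u_def left_diff_distrib sum_distrib_right mult.assoc
    using that le zyi centered_mult_integrable by auto
  have cross: "(\<integral>\<omega>. u a \<omega> * centered i \<omega> $ b \<partial>M) = C k i $ a $ b - (R ** D i) $ a $ b"
    if "i \<le> N" for a i b
    unfolding u_def left_diff_distrib sum_distrib_right mult.assoc
    using that le zyi centered_mult_integrable
    by (simp add: C cov_matrix_centered matrix_matrix_mult_def Dz)
  have Ceq: "C k i = R ** D i \<longleftrightarrow> (\<forall>a b. (\<integral>\<omega>. u a \<omega> * centered i \<omega> $ b \<partial>M) = 0)" if "i \<le> N" for i
    using cross[OF that] by (simp add: vec_eq_iff)
  \<comment> \<open>The two column blocks of R G = B are exactly these two identities.\<close>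
  have trivial: "C k i = R ** D i" if "i \<in> {j, c}" for i
  proof -
    from that have "C k i $ a $ b = (R ** D i) $ a $ b" for a b
    proof
      assume "i = j"
      moreover have "(R ** G) $ a $ Inl b = B $ a $ Inl b" by (simp only: RG)
      moreover have "G $ q $ Inl b = D j $ q $ b" for q
        by (cases q) (auto simp: G_def D_def vblock_def hblock_def)
      ultimately show ?thesis
        by (simp add: matrix_matrix_mult_def B_def hblock_def)
    next
      assume "i \<in> {c}"
      moreover have "(R ** G) $ a $ Inr b = B $ a $ Inr b" by (simp only: RG)
      moreover have "G $ q $ Inr b = D c $ q $ b" for q
        by (cases q) (auto simp: G_def D_def vblock_def hblock_def)
      ultimately show ?thesis
        by (simp add: matrix_matrix_mult_def B_def hblock_def)
    qed
    thus ?thesis by (simp add: vec_eq_iff)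
  qed

  \<comment> \<open>The residual as a linear functional and its independence\<close>
  have lin_p: "(\<Sum>i\<in>{0..N}. p s i \<bullet> z i) = s \<bullet> z k - \<alpha> s \<bullet> z j - \<beta> s \<bullet> z c"
    for s and z :: "nat \<Rightarrow> real^'d"
  proof -
    have "(\<Sum>i\<in>{0..N}. p s i \<bullet> z i) = (\<Sum>i\<in>{0..N}. (if i = k then s \<bullet> z i else 0)
        - (if i = j then \<alpha> s \<bullet> z i else 0) - (if i = c then \<beta> s \<bullet> z i else 0))"
      by (intro sum.cong) (auto simp: p_def inner_diff_left)
    also have "\<dots> = s \<bullet> z k - \<alpha> s \<bullet> z j - \<beta> s \<bullet> z c"
      using le by (simp add: sum_subtractf)
    finally show ?thesis .
  qed
  have \<alpha>\<beta>: "\<alpha> s \<bullet> centered j \<omega> + \<beta> s \<bullet> centered c \<omega> = (\<Sum>a\<in>UNIV. s $ a * (\<Sum>q\<in>UNIV. R $ a $ q * \<zeta> q \<omega>))" for s \<omega>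
  proof -
    have "(\<Sum>a\<in>UNIV. s $ a * (\<Sum>q\<in>UNIV. R $ a $ q * \<zeta> q \<omega>))
        = (\<Sum>q\<in>UNIV. (\<Sum>a\<in>UNIV. s $ a * R $ a $ q) * \<zeta> q \<omega>)"
      unfolding sum_distrib_left sum_distrib_right by (subst sum.swap) (simp add: mult_ac)
    thus ?thesis
      by (simp add: sum_UNIV_Plus \<alpha>_def \<beta>_def inner_vec_def \<zeta>_def)
  qed
  have lin_u: "lin (p s) \<omega> - expectation (lin (p s)) = (\<Sum>a\<in>UNIV. s $ a * u a \<omega>)" for s \<omega>
  proof -
    have "(\<Sum>a\<in>UNIV. s $ a * u a \<omega>) = s \<bullet> centered k \<omega> - (\<alpha> s \<bullet> centered j \<omega> + \<beta> s \<bullet> centered c \<omega>)"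
      unfolding \<alpha>\<beta> by (simp add: u_def right_diff_distrib sum_subtractf inner_vec_def)
    thus ?thesis unfolding lin_centered lin_p by simp
  qed
  have lin_x: "s \<bullet> x k \<omega> = lin (p s) \<omega> + (\<alpha> s \<bullet> x j \<omega> + \<beta> s \<bullet> x c \<omega>)" for s \<omega>
    unfolding lin_def lin_p by simp
  \<comment> \<open>Used twice: with U = {j, c}, where the covariance identity is automatic, and
    with U = S, where it is the assumption of the converse direction.\<close>
  have indep: "indep_var borel (\<lambda>\<omega>. f (lin (p s) \<omega>)) borel V"
    if "U \<subseteq> {0..N}" "\<And>i. i \<in> U \<Longrightarrow> C k i = R ** D i" "V \<in> borel_measurable (generated_algebra M x U)" "f \<in> borel_measurable borel"
    for s U and V :: "'a \<Rightarrow> 'e::{real_normed_field,banach,second_countable_topology}" and f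
  proof (rule indep_of_uncorrelated[OF that(1) _ that(4,3)])
    fix i b assume i: "i \<in> U"
    hence iN: "i \<le> N" using that(1) by auto
    have "(\<integral>\<omega>. (\<Sum>a\<in>UNIV. s $ a * u a \<omega>) * centered i \<omega> $ b \<partial>M)
        = (\<Sum>a\<in>UNIV. s $ a * (\<integral>\<omega>. u a \<omega> * centered i \<omega> $ b \<partial>M))"
      using uyi[OF iN] by (simp add: sum_distrib_right mult.assoc)
    also have "\<dots> = 0" using Ceq[OF iN] that(2)[OF i] by simp
    finally show "(\<integral>\<omega>. (lin (p s) \<omega> - expectation (lin (p s))) * centered i \<omega> $ b \<partial>M) = 0"
      unfolding lin_u .
  qed

  \<comment> \<open>Conditional probabilities and the centred weights\<close>
  let ?S = "generated_algebra M x S" and ?T = "generated_algebra M x {j, c}"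
  have subS: "subalgebra M ?S" by (rule subalgebra_generated_algebra) (use iS in auto)
  have subT: "subalgebra M ?T" by (rule subalgebra_generated_algebra) (use le in auto)
  have TS: "sets ?T \<subseteq> sets ?S" by (rule generated_algebra_mono) (use S in auto)
  have subST: "subalgebra ?S ?T" using TS by (simp add: subalgebra_def)
  interpret S: finite_measure_subalgebra M ?S by unfold_locales (rule subS)
  interpret T: finite_measure_subalgebra M ?T by unfold_locales (rule subT)
  define P where "P F = real_cond_exp M ?T (indicator F)" for F :: "'a set"
  have PT[measurable]: "P F \<in> borel_measurable ?T" for F by (simp add: P_def)
  have PM[measurable]: "P F \<in> borel_measurable M" for F by (simp add: P_def)
  have Fi: "F \<in> sets M" "integrable M (indicator F :: 'a \<Rightarrow> real)" if "F \<in> sets ?S" for F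
  proof -
    show "F \<in> sets M" using subS that by (auto simp: subalgebra_def)
    thus "integrable M (indicator F :: 'a \<Rightarrow> real)" by (simp add: emeasure_eq_measure)
  qed
  have Pi: "integrable M (P F)" if "F \<in> sets ?S" for F
    unfolding P_def by (rule T.real_cond_exp_int(1)[OF Fi(2)[OF that]])
  have xjT: "x j \<in> borel_measurable ?T" "x c \<in> borel_measurable ?T"
    by (auto intro: measurable_generated_algebra)
  have LT: "(\<lambda>\<omega>. \<alpha> s \<bullet> x j \<omega> + \<beta> s \<bullet> x c \<omega>) \<in> borel_measurable ?T" for s
    using xjT by simp
  have LM[measurable]: "(\<lambda>\<omega>. \<alpha> s \<bullet> x j \<omega> + \<beta> s \<bullet> x c \<omega>) \<in> borel_measurable M" for s
    by (rule measurable_from_subalg[OF subT LT])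
  have W0: "(\<integral>\<omega>. (indicator F \<omega> - P F \<omega>) * f \<omega> \<partial>M) = 0"
      and Pf: "integrable M (\<lambda>\<omega>. P F \<omega> * f \<omega>)"
    if "F \<in> sets ?S" "f \<in> borel_measurable ?T" "integrable M f" for F f
    using integral_centered_cond_prob_zero[OF subT Fi(1)[OF that(1)] that(2,3)] by (auto simp: P_def)
  have Ev[measurable]: "{\<omega>\<in>space M. x k \<omega> \<le> \<xi>} \<in> sets M" for \<xi>
  proof -
    have "x k -` {..\<xi>} \<inter> space M \<in> sets M" by (rule measurable_sets[OF x_measurable[OF le(2)]]) simp
    also have "x k -` {..\<xi>} \<inter> space M = {\<omega>\<in>space M. x k \<omega> \<le> \<xi>}" by auto
    finally show ?thesis .
  qed
  have cdf_iff: "(AE \<omega> in M. cond_cdf M (x k) x S \<xi> \<omega> = cond_cdf M (x k) x {j, c} \<xi> \<omega>) \<longleftrightarrow>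
    (\<forall>F\<in>sets ?S. (\<integral>\<omega>. indicator {\<omega>\<in>space M. x k \<omega> \<le> \<xi>} \<omega> * (indicator F \<omega> - P F \<omega>) \<partial>M) = 0)" for \<xi>
    unfolding cond_cdf_def P_def by (rule real_cond_exp_indicator_eq_iff[OF subS subT TS Ev])
  have "(\<forall>\<xi>. AE \<omega> in M. cond_cdf M (x k) x S \<xi> \<omega> = cond_cdf M (x k) x {j, c} \<xi> \<omega>) \<longleftrightarrow>
    (\<forall>i\<in>S. C k i = R ** D i)"
  proof

    \<comment> \<open>From equal conditional CDFs to the covariance identity\<close>
    assume cdf: "\<forall>\<xi>. AE \<omega> in M. cond_cdf M (x k) x S \<xi> \<omega> = cond_cdf M (x k) x {j, c} \<xi> \<omega>"
    have uF: "(\<integral>\<omega>. indicator F \<omega> * u a \<omega> \<partial>M) = 0" if F: "F \<in> sets ?S" for F a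
    proof -
      define s :: "real^'d" where "s = axis a 1"
      have sx: "s \<bullet> v = v $ a" for v by (simp add: s_def inner_axis')
      have lu: "lin (p s) \<omega> = expectation (lin (p s)) + u a \<omega>" for \<omega>
        using lin_u[of s \<omega>] by (simp add: s_def axis_def if_distrib[of "\<lambda>z. z * _"] cong: if_cong)
      note FM = Fi[OF F]
      \<comment> \<open>\<open>P F\<close> is measurable for the algebra of \<open>x j\<close> and
        \<open>x c\<close>, from which the residual is always independent; as \<open>u a\<close> has
        mean zero, this leads to E(u P F) = 0.\<close>
      have ind: "indep_var borel (lin (p s)) borel (P F)"
        by (rule indep[of "{j, c}" _ "\<lambda>z. z"]) (use le trivial PT in auto)
      have Pl: "integrable M (\<lambda>\<omega>. lin (p s) \<omega> * P F \<omega>)"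
        by (rule indep_var_integrable[OF ind lin_integrable Pi[OF F]])
      have "(\<integral>\<omega>. lin (p s) \<omega> * P F \<omega> \<partial>M) = expectation (lin (p s)) * expectation (P F)"
        by (rule indep_var_lebesgue_integral[OF ind lin_integrable Pi[OF F]])
      moreover have lP: "lin (p s) \<omega> * P F \<omega> = expectation (lin (p s)) * P F \<omega> + u a \<omega> * P F \<omega>" for \<omega>
        by (subst lu) (simp add: distrib_right)
      moreover have uP: "integrable M (\<lambda>\<omega>. u a \<omega> * P F \<omega>)"
      proof -
        have "u a \<omega> * P F \<omega> = lin (p s) \<omega> * P F \<omega> - expectation (lin (p s)) * P F \<omega>" for \<omega>
          using lP by simp
        thus ?thesis using Pl Pi[OF F] by simp
      qed
      ultimately have uP0: "(\<integral>\<omega>. u a \<omega> * P F \<omega> \<partial>M) = 0"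
        using Pi[OF F] by simp
      let ?L = "\<lambda>\<omega>. \<alpha> s \<bullet> x j \<omega> + \<beta> s \<bullet> x c \<omega>"
      have Li: "integrable M ?L" using le by (intro Bochner_Integration.integrable_add integrable_inner_right x_integrable)
      have xk: "x k \<omega> $ a = lin (p s) \<omega> + ?L \<omega>" for \<omega> using lin_x[of s \<omega>] by (simp only: sx)
      have iF: "integrable M (\<lambda>\<omega>. indicator F \<omega> * f \<omega>)" if "integrable M f" for f :: "'a \<Rightarrow> real"
        using integrable_mult_indicator[OF FM(1) that] by simp
      \<comment> \<open>Splitting \<open>x k\<close> into residual and prediction, the product with
        \<open>P F\<close> is integrable by independence for the first part and by pull-out for the
        second.\<close>
      have xW: "integrable M (\<lambda>\<omega>. x k \<omega> $ a * (indicator F \<omega> - P F \<omega>))"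
      proof -
        have "x k \<omega> $ a * (indicator F \<omega> - P F \<omega>)
          = indicator F \<omega> * x k \<omega> $ a - lin (p s) \<omega> * P F \<omega> - P F \<omega> * ?L \<omega>" for \<omega>
          by (simp add: xk algebra_simps)
        moreover have "integrable M (\<lambda>\<omega>. indicator F \<omega> * x k \<omega> $ a)"
          by (intro iF component_integrable le)
        ultimately show ?thesis using Pl Pf[OF F LT Li] by simp
      qed
      have Wi: "integrable M (\<lambda>\<omega>. indicator F \<omega> - P F \<omega>)"
        by (rule Bochner_Integration.integrable_diff[OF FM(2) Pi[OF F]])
      have W00: "(\<integral>\<omega>. (indicator F \<omega> - P F \<omega>) \<partial>M) = 0"
        unfolding Bochner_Integration.integral_diff[OF FM(2) Pi[OF F]]
        using T.real_cond_exp_int(2)[OF FM(2)] by (simp only: P_def)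
      have "(\<integral>\<omega>. indicator {\<omega>\<in>space M. x k \<omega> \<le> \<xi>} \<omega> * (indicator F \<omega> - P F \<omega>) \<partial>M) = 0" for \<xi>
        using cdf F unfolding cdf_iff by blast
      \<comment> \<open>The CDF condition passes from indicators of orthants to the unbounded
        coordinate function v \<mapsto> \<open>v $ a\<close>.\<close>
      from integral_mult_zero_of_cdf_zero[OF Wi W00 x_measurable[OF le(2)] this _ xW]
      have xW0: "(\<integral>\<omega>. x k \<omega> $ a * (indicator F \<omega> - P F \<omega>) \<partial>M) = 0"
        by simp
      have LW: "integrable M (\<lambda>\<omega>. (indicator F \<omega> - P F \<omega>) * ?L \<omega>)"
        using iF[OF Li] Pf[OF F LT Li] by (simp add: left_diff_distrib)
      have four: "(\<integral>\<omega>. f \<omega> - g \<omega> - e * h \<omega> + r \<omega> \<partial>M)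
          = (\<integral>\<omega>. f \<omega> \<partial>M) - (\<integral>\<omega>. g \<omega> \<partial>M) - e * (\<integral>\<omega>. h \<omega> \<partial>M) + (\<integral>\<omega>. r \<omega> \<partial>M)"
        if "integrable M f" "integrable M g" "integrable M h" "integrable M r"
        for f g h r :: "'a \<Rightarrow> real" and e
        using that by simp
      let ?E = "expectation (lin (p s))"
      \<comment> \<open>Here 1_F = W + P F with W = 1_F - P F, and u = x_k - L - E coordinatewise;
        each of the four resulting terms integrates to zero.\<close>
      have "indicator F \<omega> * u a \<omega> = x k \<omega> $ a * (indicator F \<omega> - P F \<omega>) - (indicator F \<omega> - P F \<omega>) * ?L \<omega>
          - ?E * (indicator F \<omega> - P F \<omega>) + u a \<omega> * P F \<omega>" for \<omega>
        unfolding xk by (subst lu) (simp add: algebra_simps)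
      hence "(\<integral>\<omega>. indicator F \<omega> * u a \<omega> \<partial>M) =
        (\<integral>\<omega>. x k \<omega> $ a * (indicator F \<omega> - P F \<omega>) - (indicator F \<omega> - P F \<omega>) * ?L \<omega>
          - ?E * (indicator F \<omega> - P F \<omega>) + u a \<omega> * P F \<omega> \<partial>M)" by simp
      also have "\<dots> = (\<integral>\<omega>. x k \<omega> $ a * (indicator F \<omega> - P F \<omega>) \<partial>M)
          - (\<integral>\<omega>. (indicator F \<omega> - P F \<omega>) * ?L \<omega> \<partial>M)
          - ?E * (\<integral>\<omega>. (indicator F \<omega> - P F \<omega>) \<partial>M) + (\<integral>\<omega>. u a \<omega> * P F \<omega> \<partial>M)"
        by (rule four[OF xW LW Wi uP])
      also have "\<dots> = 0"
        by (simp only: xW0 W0[OF F LT Li] uP0 W00 mult_zero_right diff_zero add_0_right)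
      finally show ?thesis .
    qed
    show "\<forall>i\<in>S. C k i = R ** D i"
    proof
      fix i assume i: "i \<in> S"
      have "(\<integral>\<omega>. u a \<omega> * centered i \<omega> $ b \<partial>M) = 0" for a b
      proof -
        \<comment> \<open>\<open>uF\<close> says that the residual has conditional mean zero given
          \<open>S\<close>, so it is orthogonal to the \<open>S\<close>-measurable
          \<open>centered i\<close>.\<close>
        have "AE \<omega> in M. real_cond_exp M ?S (u a) \<omega> = 0"
          using uF ui by (intro S.real_cond_exp_charact) (auto simp: set_lebesgue_integral_def)
        hence "(\<integral>\<omega>. centered i \<omega> $ b * real_cond_exp M ?S (u a) \<omega> \<partial>M) = 0"
          by (intro integral_eq_zero_AE) auto
        moreover have "(\<lambda>\<omega>. centered i \<omega> $ b) \<in> borel_measurable ?S"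
          unfolding centered_def using measurable_generated_algebra[OF i, of x M] by simp
        ultimately show ?thesis
          using S.real_cond_exp_intg(2)[of "\<lambda>\<omega>. centered i \<omega> $ b" "u a"] uyi[OF iS[OF i]] ui
          by (auto simp: mult.commute)
      qed
      thus "C k i = R ** D i" using Ceq[OF iS[OF i]] by simp
    qed
  next

    \<comment> \<open>From the covariance identity to equal conditional CDFs\<close>
    assume eq: "\<forall>i\<in>S. C k i = R ** D i"
    show "\<forall>\<xi>. AE \<omega> in M. cond_cdf M (x k) x S \<xi> \<omega> = cond_cdf M (x k) x {j, c} \<xi> \<omega>"
      unfolding cdf_iff
    proof (intro allI ballI)
      fix \<xi> F assume F: "F \<in> sets ?S"
      note FM = Fi[OF F]
      let ?W = "\<lambda>\<omega>. complex_of_real (indicator F \<omega> - P F \<omega>)"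
      have Wi: "integrable M ?W" using FM Pi[OF F] by simp
      have "(\<integral>\<omega>. indicator {\<omega>\<in>space M. x k \<omega> \<le> \<xi>} \<omega> *\<^sub>R ?W \<omega> \<partial>M) = 0"
      proof (rule integral_zero_generated_algebra_of_char_zero[of "{k}" x, OF _ _ Wi])
        show "{\<omega>\<in>space M. x k \<omega> \<le> \<xi>} \<in> sets (generated_algebra M x {k})"
        proof -
          have "x k -` {..\<xi>} \<inter> space (generated_algebra M x {k}) \<in> sets (generated_algebra M x {k})"
            by (rule measurable_sets[OF measurable_generated_algebra]) auto
          moreover have "x k -` {..\<xi>} \<inter> space (generated_algebra M x {k}) = {\<omega>\<in>space M. x k \<omega> \<le> \<xi>}" by auto
          ultimately show ?thesis by simp
        qed
      next
        fix q :: "nat \<Rightarrow> real^'d"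
        define s where "s = q k"
        let ?L = "\<lambda>\<omega>. \<alpha> s \<bullet> x j \<omega> + \<beta> s \<bullet> x c \<omega>"
        \<comment> \<open>Since s . x_k = lin (p s) + L, the transform to be killed is E(cis (lin (p
          s)) V). \<open>V\<close> collects all \<open>S\<close>-measurable factors, so the residual
          factor is independent of it.\<close>
        define V where "V \<omega> = ?W \<omega> * cis (?L \<omega>)" for \<omega>
        have cism: "cis \<in> borel_measurable borel" by (simp add: cis_conv_exp[abs_def])
        have VS: "V \<in> borel_measurable ?S"
        proof -
          have "?L \<in> borel_measurable ?S" "P F \<in> borel_measurable ?S"
            by (rule measurable_from_subalg[OF subST LT], rule measurable_from_subalg[OF subST PT])
          moreover from this(1) have "(\<lambda>\<omega>. cis (?L \<omega>)) \<in> borel_measurable ?S"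
            by (rule measurable_compose[OF _ cism])
          ultimately show ?thesis
            unfolding V_def using F by (intro borel_measurable_times borel_measurable_of_real borel_measurable_diff) auto
        qed
        have VM[measurable]: "V \<in> borel_measurable M" by (rule measurable_from_subalg[OF subS VS])
        have Vi: "integrable M V"
          by (rule Bochner_Integration.integrable_bound[OF Wi VM]) (simp add: V_def norm_mult)
        have V0: "expectation V = 0"
        proof -
          have "integrable M (\<lambda>\<omega>. cos (?L \<omega>))" "integrable M (\<lambda>\<omega>. sin (?L \<omega>))"
            by (auto intro!: integrable_const_bound[of _ 1])
          \<comment> \<open>Real and imaginary parts of \<open>V\<close> are the weight times
            bounded functions of \<open>x j\<close> and \<open>x c\<close>, to which the weight is
            orthogonal.\<close>
          hence "(\<integral>\<omega>. (indicator F \<omega> - P F \<omega>) * cos (?L \<omega>) \<partial>M) = 0"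
            "(\<integral>\<omega>. (indicator F \<omega> - P F \<omega>) * sin (?L \<omega>) \<partial>M) = 0"
            using LT by (auto intro!: W0[OF F])
          moreover have "Re (V \<omega>) = (indicator F \<omega> - P F \<omega>) * cos (?L \<omega>)"
            "Im (V \<omega>) = (indicator F \<omega> - P F \<omega>) * sin (?L \<omega>)" for \<omega>
            by (simp_all add: V_def)
          ultimately show ?thesis
            using Vi by (simp add: complex_eq_iff integral_Re[symmetric] integral_Im[symmetric] del: integral_Re integral_Im)
        qed
        have ind: "indep_var borel (\<lambda>\<omega>. cis (lin (p s) \<omega>)) borel V"
          by (rule indep[OF S(1) _ VS cism]) (use eq in auto)
        have "integrable M (\<lambda>\<omega>. cis (lin (p s) \<omega>))"
          by (rule integrable_const_bound[of _ 1]) (auto simp: cis_conv_exp)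
        from indep_var_lebesgue_integral[OF ind this Vi] V0
        have "(\<integral>\<omega>. cis (lin (p s) \<omega>) * V \<omega> \<partial>M) = 0" by simp
        moreover have "?W \<omega> * cis (\<Sum>i\<in>{k}. q i \<bullet> x i \<omega>) = cis (lin (p s) \<omega>) * V \<omega>" for \<omega>
          using lin_x[of s \<omega>] by (simp add: V_def s_def cis_mult[symmetric] mult_ac)
        ultimately show "(\<integral>\<omega>. ?W \<omega> * cis (\<Sum>i\<in>{k}. q i \<bullet> x i \<omega>) \<partial>M) = 0" by simp
      qed (use le in auto)
      also have "(\<lambda>\<omega>. indicator {\<omega>\<in>space M. x k \<omega> \<le> \<xi>} \<omega> *\<^sub>R ?W \<omega>)
        = (\<lambda>\<omega>. complex_of_real (indicator {\<omega>\<in>space M. x k \<omega> \<le> \<xi>} \<omega> * (indicator F \<omega> - P F \<omega>)))"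
        by (simp add: scaleR_conv_of_real)
      finally show "(\<integral>\<omega>. indicator {\<omega>\<in>space M. x k \<omega> \<le> \<xi>} \<omega> * (indicator F \<omega> - P F \<omega>) \<partial>M) = 0"
        by (simp only: integral_complex_of_real of_real_eq_0_iff)
    qed
  qed
  also have "(\<forall>i\<in>S. C k i = R ** D i) \<longleftrightarrow> (\<forall>i\<in>S - {j, c}. C k i = R ** D i)"
    using trivial by blast
  finally show ?thesis unfolding R_def B_def G_def D_def .
qed

text \<open>The event is measurable for the conditioning algebra, so its conditional probability is
  its indicator. This settles the instances of the Markov condition with k = c.\<close>

lemma cond_cdf_self:
  assumes "k \<le> N" "k \<in> S" "S \<subseteq> {0..N}"
  shows "AE \<omega> in M. cond_cdf M (x k) x S \<xi> \<omega> = indicator {\<omega>\<in>space M. x k \<omega> \<le> \<xi>} \<omega>"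
proof -
  have sub: "subalgebra M (generated_algebra M x S)"
    using assms by (intro subalgebra_generated_algebra) auto
  interpret finite_measure_subalgebra M "generated_algebra M x S" by unfold_locales (rule sub)
  have "x k -` {..\<xi>} \<inter> space (generated_algebra M x S) \<in> sets (generated_algebra M x S)"
    by (rule measurable_sets[OF measurable_generated_algebra]) (use assms in auto)
  moreover have "x k -` {..\<xi>} \<inter> space (generated_algebra M x S) = {\<omega>\<in>space M. x k \<omega> \<le> \<xi>}" by auto
  ultimately have E: "{\<omega>\<in>space M. x k \<omega> \<le> \<xi>} \<in> sets (generated_algebra M x S)" by simp
  moreover have "{\<omega>\<in>space M. x k \<omega> \<le> \<xi>} \<in> sets M" using E sub by (auto simp: subalgebra_def)
  ultimately show ?thesis
    unfolding cond_cdf_def by (intro real_cond_exp_F_meas) (auto simp: emeasure_eq_measure)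
qed

end

theorem theorem3p3:
  fixes M :: "'a measure"
    and N c :: nat
    and x :: "nat \<Rightarrow> 'a \<Rightarrow> real^'d"
    and C :: "nat \<Rightarrow> nat \<Rightarrow> real^'d^'d"
  assumes "prob_space M"
    and "c \<in> {0, N}"
    and "gaussian_sequence M N x"
    and "\<And>l1 l2. l1 \<in> {0..N} \<Longrightarrow> l2 \<in> {0..N} \<Longrightarrow> C l1 l2 = cov_matrix M (x l1) (x l2)"
  shows "cond_markov M N c x \<longleftrightarrow>
    (\<forall>i \<in> {0..N} - {c}. \<forall>j \<in> {0..N} - {c}. \<forall>k \<in> {0..N} - {c}. i < j \<and> j < k \<longrightarrow>
       C k i =
         hblock (C k j) (C k c)
         ** moore_penrose (vblock (hblock (C j j) (C j c))
                                  (hblock (C c j) (C c c)))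
         ** vblock (C j i) (C c i))"
proof -
  interpret gaussian_seq M N x
    using assms(1,3) by (simp add: gaussian_seq_def gaussian_seq_axioms_def)
  have cN: "c \<le> N" using assms(2) by auto
  let ?eq = "\<lambda>j k. \<forall>\<xi>. AE \<omega> in M. cond_cdf M (x k) x ({0..j} \<union> {c}) \<xi> \<omega> = cond_cdf M (x k) x {j, c} \<xi> \<omega>"
  let ?mp = "\<lambda>i j k. C k i = hblock (C k j) (C k c)
         ** moore_penrose (vblock (hblock (C j j) (C j c)) (hblock (C c j) (C c c)))
         ** vblock (C j i) (C c i)"
  have main: "?eq j k \<longleftrightarrow> (\<forall>i\<in>{0..N} - {c}. i < j \<longrightarrow> ?mp i j k)" if "j < k" "k \<le> N" for j k
  proof -
    \<comment> \<open>What remains of the past after the automatic indices are removed is exactly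
      the range of \<open>i\<close> in the theorem.\<close>
    have "({0..j} \<union> {c}) - {j, c} = {i \<in> {0..N} - {c}. i < j}" using that by auto
    thus ?thesis
      using cond_cdf_eq_iff[of j k c "{0..j} \<union> {c}" C] that cN assms(4) by auto
  qed
  have triv: "?eq j k" if "j < k" "k \<le> N" "j = c \<or> k = c" for j k
  proof (cases "j = c")
    case True
    \<comment> \<open>j = c < k \<le> N rules out c = N, so c = 0 and both conditioning sets are
      {0}.\<close>
    hence "j = 0" using that assms(2) by auto
    thus ?thesis using True by simp
  next
    case False
    hence "k = c" using that by simp
    show ?thesis
    proof
      fix \<xi>
      have "AE \<omega> in M. cond_cdf M (x k) x ({0..j} \<union> {c}) \<xi> \<omega> = indicator {\<omega>\<in>space M. x k \<omega> \<le> \<xi>} \<omega>"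
        using that \<open>k = c\<close> by (intro cond_cdf_self) auto
      moreover have "AE \<omega> in M. cond_cdf M (x k) x {j, c} \<xi> \<omega> = indicator {\<omega>\<in>space M. x k \<omega> \<le> \<xi>} \<omega>"
        using that \<open>k = c\<close> by (intro cond_cdf_self) auto
      ultimately show "AE \<omega> in M. cond_cdf M (x k) x ({0..j} \<union> {c}) \<xi> \<omega> = cond_cdf M (x k) x {j, c} \<xi> \<omega>"
        by eventually_elim simp
    qed
  qed
  have skip: "(\<forall>j\<in>{0..N}. \<forall>k\<in>{0..N}. j < k \<longrightarrow> Q j k) \<longleftrightarrow>
      (\<forall>j\<in>{0..N} - {c}. \<forall>k\<in>{0..N} - {c}. j < k \<longrightarrow> Q j k)"
    if "\<And>j k. j < k \<Longrightarrow> k \<le> N \<Longrightarrow> j = c \<or> k = c \<Longrightarrow> Q j k" for Q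
  proof -
    have "Q j k" if "j \<in> {0..N}" "k \<in> {0..N}" "j < k"
        "\<forall>j\<in>{0..N} - {c}. \<forall>k\<in>{0..N} - {c}. j < k \<longrightarrow> Q j k" for j k
      using that \<open>\<And>j k. j < k \<Longrightarrow> k \<le> N \<Longrightarrow> j = c \<or> k = c \<Longrightarrow> Q j k\<close>[of j k]
      by (cases "j = c \<or> k = c") auto
    thus ?thesis by blast
  qed
  have "cond_markov M N c x \<longleftrightarrow> (\<forall>j\<in>{0..N}. \<forall>k\<in>{0..N}. j < k \<longrightarrow> ?eq j k)"
    by (simp only: cond_markov_def)
  also have "\<dots> \<longleftrightarrow> (\<forall>j\<in>{0..N} - {c}. \<forall>k\<in>{0..N} - {c}. j < k \<longrightarrow> ?eq j k)"
    by (rule skip[of ?eq, OF triv])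
  also have "\<dots> \<longleftrightarrow> (\<forall>j\<in>{0..N} - {c}. \<forall>k\<in>{0..N} - {c}. j < k \<longrightarrow>
      (\<forall>i\<in>{0..N} - {c}. i < j \<longrightarrow> ?mp i j k))"
    using main by (intro ball_cong imp_cong refl) auto
  also have "\<dots> \<longleftrightarrow> (\<forall>i\<in>{0..N} - {c}. \<forall>j\<in>{0..N} - {c}. \<forall>k\<in>{0..N} - {c}. i < j \<and> j < k \<longrightarrow> ?mp i j k)"
    by blast
  finally show ?thesis .
qed

end
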